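(* Let $A\in\mathbb{R}^{n\times n}$ have at least one eigenvalue with negative real part (i.e. $n_-\ge1$). Assume that the infinite-horizon AECS problem $$\text{minimize}_{p}\ \mathrm{tr}\bigl(Q^{-*}\,\mathrm{diag}(W_-(p)^{-1},O,O)\,Q^{-1}\bigr)\quad\text{subject to } p\in\Delta,\ W_-(p)\succ O$$ admits a unique optimal solution $p_{\mathrm{AECS}}^{\infty}$. For each $T>0$, let $p_{\mathrm{AECS}}^{T}$ be any optimal solution to the finite-horizon AECS problem $$\text{minimize}_{p}\ \mathrm{tr}\bigl(\widetilde W(p;T)^{-1}\bigr)\quad\text{subject to } p\in\Delta,\ \widetilde W(p;T)\succ O.$$ Then $p_{\mathrm{AECS}}^{T}\to p_{\mathrm{AECS}}^{\infty}$ as $T\to\infty$.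
   Context: Notation: $\Delta=\{p\in\mathbb{R}^n\mid p_i\ge0,\ \sum_ip_i=1\}$; $X\succ O$ means $X$ is Hermitian positive definite; $X^*$ is the conjugate transpose, $X^{-*}=(X^{-1})^*$; $\mathrm{diag}$ of square matrices is the block-diagonal matrix; $I_k$ is the identity and $N_k$ is the $k\times k$ nilpotent Jordan block with ones on the superdiagonal. $\widetilde W(p;T)=\int_0^T \mathrm{e}^{At}\mathrm{diag}(p)\,\mathrm{e}^{A^\top t}\,\mathrm{d}t$. Jordan form: fix a Jordan decomposition $Q^{-1}AQ=J=\mathrm{diag}(J_1,\dots,J_m)$, $Q\in\mathbb{C}^{n\times n}$ invertible, $J_i=\lambda_iI_{n_i}+N_{n_i}\in\mathbb{C}^{n_i\times n_i}$, with blocks ordered so that $\mathrm{Re}(\lambda_i)<0$ for $i\le m_-$, $\mathrm{Re}(\lambda_i)=0$ for $m_-<i\le m_-+m_0$, $\mathrm{Re}(\lambda_i)>0$ for $i>m_-+m_0$, and $\mathrm{Im}(\lambda_{m_-+1})\le\cdots\le\mathrm{Im}(\lambda_{m_-+m_0})$. Let $n_-,n_0,n_+$ be the total sizes of the blocks in the three groups and $J_-=\mathrm{diag}(J_1,\dots,J_{m_-})\in\mathbb{C}^{n_-\times n_-}$. For $p\in\mathbb{R}^n$, let $\widetilde B_{-,-}\in\mathbb{C}^{n_-\times n_-}$ be the upper-left $n_-\times n_-$ block of $Q^{-1}\mathrm{diag}(p)Q^{-*}$; $W_-(p)$ is the unique solution of $J_-W_-(p)+W_-(p)J_-^*+\widetilde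 B_{-,-}=O$. In $\mathrm{diag}(W_-(p)^{-1},O,O)$ the zero blocks have sizes $n_0\times n_0$ and $n_+\times n_+$. *)

theory Defs
  imports
    "HOL-Analysis.Analysis"
    "Jordan_Normal_Form.Jordan_Normal_Form"
    "Jordan_Normal_Form.Schur_Decomposition"
    "Jordan_Normal_Form.Gauss_Jordan_Elimination"
begin

unbundle no vec_syntax

definition std_simplex :: "nat \<Rightarrow> real Matrix.vec set" where
  "std_simplex n = {p \<in> carrier_vec n. (\<forall>i<n. 0 \<le> p $ i) \<and> (\<Sum>i<n. p $ i) = 1}"

text \<open>The inverse matrix, for invertible square arguments; unspecified otherwise.\<close>

definition mat_inv :: "'a::field Matrix.mat \<Rightarrow> 'a Matrix.mat" where
  "mat_inv X = the (mat_inverse X)"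

definition mat_trace :: "'a::comm_monoid_add Matrix.mat \<Rightarrow> 'a" where
  "mat_trace X = (\<Sum>i<dim_row X. X $$ (i, i))"

text \<open>
  Hermitian positive definite, over the complex or the real numbers. On the complex numbers
  \<open>0 < z\<close> means that \<open>z\<close> is real and positive; on the reals
  conjugation is the identity.
\<close>

definition pos_def :: "'a::conjugatable_ordered_field Matrix.mat \<Rightarrow> bool" where
  "pos_def X \<longleftrightarrow> square_mat X \<and> mat_adjoint X = X \<and>
     (\<forall>v \<in> carrier_vec (dim_row X). v \<noteq> 0\<^sub>v (dim_row X) \<longrightarrow> 0 < (X *\<^sub>v v) \<bullet>c v)"

definition diag_of_vec :: "'a::zero Matrix.vec \<Rightarrow> 'a Matrix.mat" where
  "diag_of_vec p = mat_diag (dim_vec p) (\<lambda>i. p $ i)"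

text \<open>The matrix exponential; the series is taken entrywise.\<close>

definition mat_exp :: "real Matrix.mat \<Rightarrow> real Matrix.mat" where
  "mat_exp X = Matrix.mat (dim_row X) (dim_row X) (\<lambda>(i, j). \<Sum>k. (X ^\<^sub>m k) $$ (i, j) / fact k)"

text \<open>The finite-horizon Gramian; the integral is taken entrywise.\<close>

definition gramian :: "real Matrix.mat \<Rightarrow> real Matrix.vec \<Rightarrow> real \<Rightarrow> real Matrix.mat" where
  "gramian A p T = Matrix.mat (dim_row A) (dim_row A) (\<lambda>(i, j).
     integral {0..T} (\<lambda>t.
       (mat_exp (t \<cdot>\<^sub>m A) * diag_of_vec p * mat_exp (t \<cdot>\<^sub>m transpose_mat A)) $$ (i, j)))"

definition aecs_cost :: "real Matrix.mat \<Rightarrow> real \<Rightarrow> real Matrix.vec \<Rightarrow> real" where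
  "aecs_cost A T p = mat_trace (mat_inv (gramian A p T))"

definition aecs_feasible :: "real Matrix.mat \<Rightarrow> real \<Rightarrow> real Matrix.vec \<Rightarrow> bool" where
  "aecs_feasible A T p \<longleftrightarrow> p \<in> std_simplex (dim_row A) \<and> pos_def (gramian A p T)"

text \<open>
  A list of Jordan blocks is a list of pairs (size, eigenvalue), as in \<^const>\<open>jordan_matrix\<close>.
  The arguments \<open>bm\<close>, \<open>bz\<close>, \<open>bp\<close> below are the blocks whose
  eigenvalue has negative, zero and positive real part, respectively.
\<close>

definition blocks_size :: "(nat \<times> complex) list \<Rightarrow> nat" where
  "blocks_size bs = sum_list (map fst bs)"

definition ordered_jordan_decomposition ::
  "real Matrix.mat \<Rightarrow> complex Matrix.mat \<Rightarrow> (nat \<times> complex) list \<Rightarrow> (nat \<times> complex) list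
     \<Rightarrow> (nat \<times> complex) list \<Rightarrow> bool" where
  "ordered_jordan_decomposition A Q bm bz bp \<longleftrightarrow>
     similar_mat_wit (map_mat complex_of_real A) (jordan_matrix (bm @ bz @ bp)) Q (mat_inv Q) \<and>
     (\<forall>(k, l) \<in> set (bm @ bz @ bp). k > 0) \<and>
     (\<forall>(k, l) \<in> set bm. Re l < 0) \<and>
     (\<forall>(k, l) \<in> set bz. Re l = 0) \<and>
     (\<forall>(k, l) \<in> set bp. Re l > 0) \<and>
     sorted (map (\<lambda>(k, l). Im l) bz)"

definition B_minus ::
  "complex Matrix.mat \<Rightarrow> (nat \<times> complex) list \<Rightarrow> real Matrix.vec \<Rightarrow> complex Matrix.mat" where
  "B_minus Q bm p =
     fst (split_block
       (mat_inv Q * map_mat complex_of_real (diag_of_vec p) * mat_adjoint (mat_inv Q))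
       (blocks_size bm) (blocks_size bm))"

definition W_minus ::
  "complex Matrix.mat \<Rightarrow> (nat \<times> complex) list \<Rightarrow> real Matrix.vec \<Rightarrow> complex Matrix.mat" where
  "W_minus Q bm p = (THE W. W \<in> carrier_mat (blocks_size bm) (blocks_size bm) \<and>
     jordan_matrix bm * W + W * mat_adjoint (jordan_matrix bm) + B_minus Q bm p
       = 0\<^sub>m (blocks_size bm) (blocks_size bm))"

text \<open>
  On feasible points the trace below is a nonnegative real number, so taking the real part
  only serves to make the cost real-valued.
\<close>

definition aecs_cost_inf ::
  "complex Matrix.mat \<Rightarrow> (nat \<times> complex) list \<Rightarrow> (nat \<times> complex) list \<Rightarrow> (nat \<times> complex) list
     \<Rightarrow> real Matrix.vec \<Rightarrow> real" where
  "aecs_cost_inf Q bm bz bp p = Re (mat_trace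
     (mat_adjoint (mat_inv Q) *
      diag_block_mat [mat_inv (W_minus Q bm p),
        0\<^sub>m (blocks_size bz) (blocks_size bz), 0\<^sub>m (blocks_size bp) (blocks_size bp)] *
      mat_inv Q))"

definition aecs_feasible_inf ::
  "complex Matrix.mat \<Rightarrow> (nat \<times> complex) list \<Rightarrow> real Matrix.vec \<Rightarrow> bool" where
  "aecs_feasible_inf Q bm p \<longleftrightarrow> p \<in> std_simplex (dim_row Q) \<and> pos_def (W_minus Q bm p)"

end

theory Submission
  imports Defs
begin

text \<open>
  The proof rests on the variational formula
  \<open>c\<^sup>* M\<^sup>-\<^sup>1 c = sup\<^sub>v (2 Re (c\<^sup>* v) - v\<^sup>* M v)\<close>. Restricting \<open>v\<close> to the stable subspace bounds
  the finite-horizon cost from below by the infinite-horizon expression, which is affine in \<open>p\<close> for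
  fixed \<open>v\<close> and hence passes to limits of optimal \<open>p\<close>; unboundedness of the supremum for singular
  \<open>W\<^sub>-(p)\<close> shows that such limits are feasible. Conversely, for strictly positive \<open>p\<close> the columns
  of \<open>W(p;T)\<^sup>-\<^sup>1\<close> accumulate only at initial values of trajectories of \<open>x' = A\<^sup>T x\<close> with finite energy.
  These lie in the stable subspace, so the finite-horizon cost is asymptotically at most the
  infinite-horizon one. Mixing the infinite-horizon optimum with a little of the uniform distribution
  makes it strictly positive, so every limit point of finite-horizon optima is an infinite-horizon
  optimum.
\<close>

section \<open>Preliminaries\<close>

text \<open>When \<open>A\<close> has eigenvalues with nonnegative real part, the Gramian need not
  converge, and no uniform convergence of the costs on the simplex is available: weights of
  finite-horizon optima may tend to zero. Hence the two comparisons are asymmetric. The lower one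
  holds for every feasible \<open>p\<close> at every horizon. The upper one is proved for a fixed
  strictly positive \<open>p\<close>, because a bound on the weighted energy
  \<open>\<Sum>k<n. p k * energy z T k\<close> controls the unweighted energy, which detects the
  non-decaying modes, only if no weight vanishes. All quadratic forms are rewritten as weighted
  energies whose coefficients do not depend on \<open>p\<close>; this is the source of affineness in
  \<open>p\<close>. The matrix \<open>W_-(p)\<close> itself is obtained by back substitution, not as
  an improper integral. Costs are compared one diagonal entry at a time: entry \<open>i\<close> of
  the inverse Gramian against \<open>c^* W_-(p)^-1 c\<close>, where \<open>c\<close> holds the first
  \<open>m\<close> entries of column \<open>i\<close> of \<open>Q^-1\<close>.\<close>

definition sesq :: "nat \<Rightarrow> (nat \<Rightarrow> nat \<Rightarrow> complex) \<Rightarrow> (nat \<Rightarrow> complex) \<Rightarrow> (nat \<Rightarrow> complex) \<Rightarrow> complex" where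
  "sesq n M z w = (\<Sum>i<n. \<Sum>j<n. cnj (z i) * M i j * w j)"

lemma sesq_cong:
  assumes "\<And>i j. i < n \<Longrightarrow> j < n \<Longrightarrow> M i j = M' i j"
    and "\<And>i. i < n \<Longrightarrow> z i = z' i" "\<And>i. i < n \<Longrightarrow> w i = w' i"
  shows "sesq n M z w = sesq n M' z' w'"
  unfolding sesq_def using assms by (intro sum.cong refl) auto

lemma sesq_apply:
  assumes "\<And>i. i < n \<Longrightarrow> (\<Sum>j<n. M i j * w j) = c i"
  shows "sesq n M z w = (\<Sum>i<n. cnj (z i) * c i)"
  unfolding sesq_def using assms
  by (intro sum.cong refl) (simp add: sum_distrib_left[symmetric] mult.assoc)

lemma sesq_hermitian:
  assumes "\<And>i j. i < n \<Longrightarrow> j < n \<Longrightarrow> M j i = cnj (M i j)"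
  shows "sesq n M w z = cnj (sesq n M z w)"
proof -
  have "cnj (sesq n M z w) = (\<Sum>i<n. \<Sum>j<n. cnj (w j) * M j i * z i)"
    unfolding sesq_def cnj_sum by (intro sum.cong refl) (simp add: assms[symmetric])
  also have "\<dots> = sesq n M w z"
    unfolding sesq_def by (subst sum.swap) simp
  finally show ?thesis by simp
qed

lemma sesq_diff:
  "sesq n M (\<lambda>i. u i - v i) (\<lambda>i. u i - v i) = sesq n M u u - sesq n M u v - sesq n M v u + sesq n M v v"
  unfolding sesq_def by (simp add: algebra_simps sum.distrib sum_subtractf)

lemma sesq_uminus: "sesq n M (\<lambda>i. - v i) (\<lambda>i. - v i) = sesq n M v v"
  unfolding sesq_def by simp

lemma sesq_scale:
  "sesq n M (\<lambda>i. s * v i) (\<lambda>i. s * v i) = of_real ((cmod s)\<^sup>2) * sesq n M v v"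
proof -
  have "cnj (s * v i) * M i j * (s * v j) = (s * cnj s) * (cnj (v i) * M i j * v j)" for i j
    by (simp add: ac_simps)
  then show ?thesis
    unfolding sesq_def by (simp only: sum_distrib_left complex_norm_square)
qed

text \<open>The right-hand side is \<open>c\<^sup>* M\<^sup>-\<^sup>1 c\<close>; it is attained at \<open>v = u\<close>.\<close>

lemma psd_dual_bound:
  assumes herm: "\<And>i j. i < n \<Longrightarrow> j < n \<Longrightarrow> M j i = cnj (M i j)"
    and psd: "\<And>z. 0 \<le> Re (sesq n M z z)"
    and u: "\<And>i. i < n \<Longrightarrow> (\<Sum>j<n. M i j * u j) = c i"
  shows "2 * Re (\<Sum>i<n. cnj (c i) * v i) - Re (sesq n M v v) \<le> Re (\<Sum>i<n. cnj (c i) * u i)"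
proof -
  let ?a = "\<Sum>i<n. cnj (c i) * v i" and ?b = "\<Sum>i<n. cnj (c i) * u i"
  have "sesq n M v u = (\<Sum>i<n. cnj (v i) * c i)" "sesq n M u u = (\<Sum>i<n. cnj (u i) * c i)"
    by (auto intro: sesq_apply u)
  moreover have "(\<Sum>i<n. cnj (v i) * c i) = cnj ?a" "(\<Sum>i<n. cnj (u i) * c i) = cnj ?b"
    by (simp_all add: mult.commute)
  ultimately have vu: "sesq n M v u = cnj ?a" and uu: "sesq n M u u = cnj ?b"
    by (simp_all only:)
  have "sesq n M u v = cnj (sesq n M v u)"
    using herm by (rule sesq_hermitian)
  then have uv: "sesq n M u v = ?a"
    unfolding vu complex_cnj_cnj .
  have "0 \<le> Re (cnj ?b - ?a - cnj ?a + sesq n M v v)"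
    using psd[of "\<lambda>i. u i - v i"] unfolding sesq_diff uu uv vu .
  then show ?thesis
    unfolding minus_complex.sel plus_complex.sel cnj.sel by linarith
qed

text \<open>Bolzano-Weierstrass one coordinate at a time; the dimension \<open>n\<close> is a number
  and not a type, so compactness in a Euclidean space type does not apply directly.\<close>

lemma bounded_seq_subseq_convergent:
  fixes f :: "nat \<Rightarrow> nat \<Rightarrow> real"
  assumes "\<And>j. j < n \<Longrightarrow> \<exists>C. \<forall>k. \<bar>f k j\<bar> \<le> C"
  shows "\<exists>s l. strict_mono s \<and> (\<forall>j<n. (\<lambda>k. f (s k) j) \<longlonglongrightarrow> l j)"
  using assms
proof (induction n)
  case 0
  show ?case by (intro exI[of _ id]) (auto simp: strict_mono_def)
next
  case (Suc n)
  then obtain s l where s: "strict_mono (s :: nat \<Rightarrow> nat)" "\<forall>j<n. (\<lambda>k. f (s k) j) \<longlonglongrightarrow> l j"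
    by fastforce
  obtain C where "\<forall>k. \<bar>f k n\<bar> \<le> C" using Suc.prems by blast
  then have "bounded (range (\<lambda>k. f (s k) n))"
    by (auto simp: bounded_iff)
  then obtain x s' where s': "strict_mono (s' :: nat \<Rightarrow> nat)" "((\<lambda>k. f (s k) n) \<circ> s') \<longlonglongrightarrow> x"
    using bounded_imp_convergent_subsequence by blast
  have "(\<lambda>k. f ((s \<circ> s') k) j) \<longlonglongrightarrow> (l(n := x)) j" if "j < Suc n" for j
  proof (cases "j = n")
    case True
    then show ?thesis using s'(2) by (simp add: o_def)
  next
    case False
    then have "(\<lambda>k. f (s k) j) \<longlonglongrightarrow> l j" using s that by simp
    from LIMSEQ_subseq_LIMSEQ[OF this s'(1)] False show ?thesis by (simp add: o_def)
  qed
  moreover have "strict_mono (s \<circ> s')" using s(1) s'(1) by (rule strict_mono_o)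
  ultimately show ?case by blast
qed

section \<open>Scalar linear differential equations\<close>

lemma linear_ode_unique:
  fixes f :: "real \<Rightarrow> complex"
  assumes "\<And>t. (f has_vector_derivative c * f t) (at t)"
  shows "f t = exp (c * of_real t) * f 0"
proof -
  have "((\<lambda>t. exp (- c * of_real t) * f t) has_vector_derivative 0) (at t within UNIV)" for t
  proof -
    have "((\<lambda>t. exp (- c * of_real t)) has_vector_derivative - c * exp (- c * of_real t)) (at t)"
      by (rule has_vector_derivative_real_field) (auto intro!: derivative_eq_intros)
    from has_vector_derivative_mult[OF this assms[of t]] show ?thesis
      by (simp add: algebra_simps)
  qed
  then obtain d where "\<And>t. exp (- c * of_real t) * f t = d"
    using has_vector_derivative_zero_constant[of UNIV] by blast
  from this[of t] this[of 0] have "exp (- (c * of_real t)) * f t = f 0" by simp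
  then show ?thesis by (simp add: exp_minus field_simps)
qed

text \<open>The integrating factor \<open>exp (- c t)\<close> turns the equation into \<open>(exp (- c t) f)' = exp (- c t) g\<close>.\<close>

lemma forced_ode_decay:
  fixes f g :: "real \<Rightarrow> complex"
  assumes f: "\<And>t. (f has_vector_derivative c * f t + g t) (at t)"
    and b: "Re c < - b"
    and g: "\<And>t. t \<ge> 0 \<Longrightarrow> cmod (g t) \<le> C * exp (- b * t)"
  shows "\<exists>D. \<forall>t\<ge>0. cmod (f t) \<le> D * exp (- b * t)"
proof (intro exI allI impI)
  fix t :: real assume t: "t \<ge> 0"
  \<comment> \<open>The gap between the decay rate of the homogeneous equation and \<open>b\<close>.
    It makes \<open>exp (- Re c * t) * exp (- b * t)\<close> equal to \<open>exp (a * t)\<close>,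
    whose primitive \<open>exp (a * t) / a\<close> absorbs the forcing.\<close>
  define a where "a = - Re c - b"
  have a: "a > 0" using b by (simp add: a_def)
  have C: "C \<ge> 0" using order_trans[OF norm_ge_zero g[of 0]] by simp
  let ?F = "\<lambda>t. exp (- c * of_real t) * f t"
  have F: "(?F has_vector_derivative exp (- c * of_real t) * g t) (at t)" for t
  proof -
    have "((\<lambda>t. exp (- c * of_real t)) has_vector_derivative - c * exp (- c * of_real t)) (at t)"
      by (rule has_vector_derivative_real_field) (auto intro!: derivative_eq_intros)
    from has_vector_derivative_mult[OF this f[of t]] show ?thesis
      by (simp add: algebra_simps)
  qed
  have P: "((\<lambda>t. C / a * exp (a * t)) has_vector_derivative C * exp (a * t)) (at t)" for t
    unfolding has_real_derivative_iff_has_vector_derivative[symmetric]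
    using a by (auto intro!: derivative_eq_intros)
  have "cmod (?F t - ?F 0) \<le> C / a * exp (a * t) - C / a * exp (a * 0)"
  proof (cases "t = 0")
    case False
    show ?thesis
    proof (rule differentiable_bound_general)
      show "0 < t" using t False by simp
      show "continuous_on {0..t} ?F" "continuous_on {0..t} (\<lambda>t. C / a * exp (a * t))"
        by (rule continuous_on_vector_derivative, rule has_vector_derivative_at_within, rule F P)+
      show "cmod (exp (- c * of_real s) * g s) \<le> C * exp (a * s)" if "0 < s" "s < t" for s
      proof -
        have "cmod (exp (- c * of_real s) * g s) \<le> exp (- Re c * s) * (C * exp (- b * s))"
          unfolding norm_mult using g[of s] that by (intro mult_mono) auto
        also have "\<dots> = C * exp (a * s)"
          by (simp add: a_def algebra_simps exp_add[symmetric])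
        finally show ?thesis .
      qed
    qed (use F P in auto)
  qed auto
  also have "\<dots> \<le> C / a * exp (a * t)" using C a by simp
  finally have "cmod (?F t) \<le> cmod (f 0) + C / a * exp (a * t)"
    using norm_triangle_ineq2[of "?F t" "f 0"] by simp
  also have "\<dots> \<le> (cmod (f 0) + C / a) * exp (a * t)"
    using a t mult_left_mono[of 1 "exp (a * t)" "cmod (f 0)"] by (simp add: algebra_simps)
  finally have "exp (- Re c * t) * cmod (f t) \<le> (cmod (f 0) + C / a) * exp (a * t)"
    by (simp add: norm_mult)
  from mult_left_mono[OF this, of "exp (Re c * t)"]
  have "exp (Re c * t) * exp (- Re c * t) * cmod (f t) \<le> (cmod (f 0) + C / a) * (exp (Re c * t) * exp (a * t))"
    by (simp add: algebra_simps)
  also have "exp (Re c * t) * exp (a * t) = exp (- b * t)"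
    by (simp add: a_def algebra_simps exp_add[symmetric])
  finally show "cmod (f t) \<le> (cmod (f 0) + C / a) * exp (- b * t)"
    by (simp add: exp_add[symmetric])
qed

section \<open>Trajectories and their energy\<close>

text \<open>
  Matrices are functions of two indices, meaningful below \<open>n\<close> (below \<open>m\<close> in the stable block). Here \<open>r = Q\<^sup>-\<^sup>1\<close>,
  \<open>E t = e\<^sup>A\<^sup>t\<close>, and \<open>J = Q\<^sup>-\<^sup>1 A Q\<close> need only be upper triangular
  with a decoupled stable block in front.
  The trajectory \<open>x\<close> solves \<open>x' = A\<^sup>T x\<close> with \<open>x(0) = z\<close>, and \<open>y = Q\<^sup>* x\<close> solves \<open>y' = J\<^sup>* y\<close>.
\<close>

locale triangular_flow =
  fixes n m :: nat
    and A :: "nat \<Rightarrow> nat \<Rightarrow> real"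
    and q r J :: "nat \<Rightarrow> nat \<Rightarrow> complex"
    and E :: "real \<Rightarrow> nat \<Rightarrow> nat \<Rightarrow> real"
  assumes m_le_n: "m \<le> n"
    and AQ: "\<And>k j. k < n \<Longrightarrow> j < n \<Longrightarrow> (\<Sum>a<n. of_real (A k a) * q a j) = (\<Sum>a<n. q k a * J a j)"
    and qr: "\<And>i j. i < n \<Longrightarrow> j < n \<Longrightarrow> (\<Sum>k<n. q i k * r k j) = (if i = j then 1 else 0)"
    and rq: "\<And>i j. i < n \<Longrightarrow> j < n \<Longrightarrow> (\<Sum>k<n. r i k * q k j) = (if i = j then 1 else 0)"
    and J_upper: "\<And>i j. j < i \<Longrightarrow> i < n \<Longrightarrow> J i j = 0"
    and J_block: "\<And>i j. i < m \<Longrightarrow> m \<le> j \<Longrightarrow> j < n \<Longrightarrow> J i j = 0"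
    and J_stable: "\<And>i. i < m \<Longrightarrow> Re (J i i) < 0"
    and J_rest: "\<And>i. m \<le> i \<Longrightarrow> i < n \<Longrightarrow> 0 \<le> Re (J i i)"
    and E_0: "\<And>i j. i < n \<Longrightarrow> j < n \<Longrightarrow> E 0 i j = (if i = j then 1 else 0)"
    and E_deriv: "\<And>i j t. i < n \<Longrightarrow> j < n \<Longrightarrow>
      ((\<lambda>t. E t i j) has_real_derivative (\<Sum>a<n. E t i a * A a j)) (at t)"
begin

definition x :: "(nat \<Rightarrow> complex) \<Rightarrow> real \<Rightarrow> nat \<Rightarrow> complex" where
  "x z t k = (\<Sum>l<n. of_real (E t l k) * z l)"

definition y :: "(nat \<Rightarrow> complex) \<Rightarrow> real \<Rightarrow> nat \<Rightarrow> complex" where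
  "y z t j = (\<Sum>k<n. cnj (q k j) * x z t k)"

definition energy :: "(nat \<Rightarrow> complex) \<Rightarrow> real \<Rightarrow> nat \<Rightarrow> real" where
  "energy z T k = integral {0..T} (\<lambda>t. (cmod (x z t k))\<^sup>2)"

text \<open>The stable subspace of the transpose of \<open>A\<close>: \<open>Q^* z\<close> has no
  component beyond the stable block, so \<open>z\<close> lies in the span of the first
  \<open>m\<close> columns of \<open>Q^-*\<close>.\<close>

definition stable :: "(nat \<Rightarrow> complex) \<Rightarrow> bool" where
  "stable z \<longleftrightarrow> (\<forall>j. m \<le> j \<and> j < n \<longrightarrow> y z 0 j = 0)"

definition lyapunov :: "(nat \<Rightarrow> real) \<Rightarrow> (nat \<Rightarrow> nat \<Rightarrow> complex) \<Rightarrow> bool" where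
  "lyapunov p W \<longleftrightarrow> (\<forall>i<m. \<forall>j<m. (\<Sum>a<m. J i a * W a j) + (\<Sum>a<m. W i a * cnj (J j a)) +
     (\<Sum>k<n. r i k * of_real (p k) * cnj (r j k)) = 0)"

lemma x_0: "k < n \<Longrightarrow> x z 0 k = z k"
proof -
  assume k: "k < n"
  have "x z 0 k = (\<Sum>l<n. if l = k then z l else 0)"
    unfolding x_def using k by (intro sum.cong refl) (auto simp: E_0)
  then show ?thesis using k by simp
qed

lemma x_deriv:
  assumes k: "k < n"
  shows "((\<lambda>t. x z t k) has_vector_derivative (\<Sum>a<n. of_real (A a k) * x z t a)) (at t)"
proof -
  have "((\<lambda>t. x z t k) has_vector_derivative (\<Sum>l<n. of_real (\<Sum>a<n. E t l a * A a k) * z l)) (at t)"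
    unfolding x_def using E_deriv k
    by (intro has_vector_derivative_sum has_vector_derivative_mult_left has_vector_derivative_of_real)
      (auto simp: has_real_derivative_iff_has_vector_derivative)
  also have "(\<Sum>l<n. of_real (\<Sum>a<n. E t l a * A a k) * z l) = (\<Sum>a<n. of_real (A a k) * x z t a)"
    unfolding x_def of_real_sum sum_distrib_left sum_distrib_right
    by (subst sum.swap) (simp add: ac_simps)
  finally show ?thesis .
qed

lemma y_deriv:
  assumes j: "j < n"
  shows "((\<lambda>t. y z t j) has_vector_derivative (\<Sum>a<n. cnj (J a j) * y z t a)) (at t)"
proof -
  have "((\<lambda>t. y z t j) has_vector_derivative
      (\<Sum>k<n. cnj (q k j) * (\<Sum>a<n. of_real (A a k) * x z t a))) (at t)"
    unfolding y_def
    by (intro has_vector_derivative_sum has_vector_derivative_mult_right x_deriv) auto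
  also have "(\<Sum>k<n. cnj (q k j) * (\<Sum>a<n. of_real (A a k) * x z t a)) =
      (\<Sum>a<n. cnj (\<Sum>k<n. of_real (A a k) * q k j) * x z t a)"
    unfolding cnj_sum sum_distrib_left sum_distrib_right
    by (subst sum.swap) (simp add: ac_simps)
  also have "\<dots> = (\<Sum>a<n. cnj (\<Sum>b<n. q a b * J b j) * x z t a)"
    using AQ j by simp
  also have "\<dots> = (\<Sum>a<n. cnj (J a j) * y z t a)"
    unfolding y_def cnj_sum sum_distrib_left sum_distrib_right
    by (subst sum.swap) (simp add: ac_simps)
  finally show ?thesis .
qed

lemma x_of_y:
  assumes k: "k < n"
  shows "x z t k = (\<Sum>j<n. cnj (r j k) * y z t j)"
proof -
  have "(\<Sum>j<n. cnj (r j k) * y z t j) = (\<Sum>l<n. cnj (\<Sum>j<n. q l j * r j k) * x z t l)"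
    unfolding y_def cnj_sum sum_distrib_left sum_distrib_right
    by (subst sum.swap) (simp add: ac_simps)
  also have "\<dots> = (\<Sum>l<n. if l = k then x z t l else 0)"
    using k by (intro sum.cong refl) (simp add: qr)
  finally show ?thesis using k by simp
qed

lemma continuous_x: "k < n \<Longrightarrow> continuous_on S (\<lambda>t. x z t k)"
  by (rule continuous_on_vector_derivative) (rule has_vector_derivative_at_within, rule x_deriv)

lemma integrable_x: "k < n \<Longrightarrow> (\<lambda>t. (cmod (x z t k))\<^sup>2) integrable_on {a..b}"
  by (intro integrable_continuous_interval continuous_intros continuous_x)

lemma energy_nonneg: "0 \<le> energy z T k"
  unfolding energy_def by (cases "(\<lambda>t. (cmod (x z t k))\<^sup>2) integrable_on {0..T}")
    (auto intro: integral_nonneg simp: not_integrable_integral)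

lemma energy_mono: "k < n \<Longrightarrow> S \<le> T \<Longrightarrow> energy z S k \<le> energy z T k"
  unfolding energy_def by (intro integral_subset_le integrable_x) auto

text \<open>\<open>J^*\<close> is lower triangular, so component \<open>j\<close> is driven only by
  components up to \<open>j\<close>. Those below \<open>m\<close> are decoupled and those from
  \<open>m\<close> to \<open>j\<close> vanish by assumption, which leaves a scalar equation.\<close>

lemma y_rest_exp:
  assumes zero: "\<And>i s. m \<le> i \<Longrightarrow> i < j \<Longrightarrow> y z s i = 0" and j: "m \<le> j" "j < n"
  shows "y z t j = exp (cnj (J j j) * of_real t) * y z 0 j"
proof (rule linear_ode_unique)
  fix s
  have "(\<Sum>a<n. cnj (J a j) * y z s a) = (\<Sum>a<n. if a = j then cnj (J a j) * y z s a else 0)"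
  proof (intro sum.cong refl)
    fix a assume "a \<in> {..<n}"
    then consider "a = j" | "a < j" "a < m" | "a < j" "m \<le> a" | "j < a" "a < n"
      using not_less by fastforce
    then show "cnj (J a j) * y z s a = (if a = j then cnj (J a j) * y z s a else 0)"
      by cases (use zero j J_block J_upper in auto)
  qed
  then show "((\<lambda>t. y z t j) has_vector_derivative cnj (J j j) * y z s j) (at s)"
    using y_deriv[OF j(2), of z s] j(2) by simp
qed

lemma y_rest_zero:
  assumes "\<And>i. m \<le> i \<Longrightarrow> i \<le> j \<Longrightarrow> y z 0 i = 0" "m \<le> j" "j < n"
  shows "y z t j = 0"
  using assms
proof (induction j arbitrary: t rule: less_induct)
  case (less j)
  have "y z s i = 0" if "m \<le> i" "i < j" for i s
    by (rule less.IH) (use less.prems that in auto)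
  from y_rest_exp[OF this less.prems(2,3), of t] show ?case using less.prems by simp
qed

lemma stableD: "stable z \<Longrightarrow> m \<le> j \<Longrightarrow> j < n \<Longrightarrow> y z t j = 0"
  by (rule y_rest_zero) (auto simp: stable_def)

text \<open>The first nonzero component of \<open>y\<close> beyond the stable block would be a pure
  exponential with nonnegative rate and never fall below its initial modulus. By Cauchy-Schwarz it
  is dominated by \<open>x\<close>, so the energy would grow at least linearly in
  \<open>T\<close>.\<close>

lemma stable_of_bounded_energy:
  assumes C: "\<And>T. 0 < T \<Longrightarrow> (\<Sum>k<n. energy z T k) \<le> C"
  shows "stable z"
proof -
  have "y z 0 j = 0" if "m \<le> j" "j < n" for j
    using that
  proof (induction j rule: less_induct)
    case (less j)
    have zero: "y z s i = 0" if "m \<le> i" "i < j" for i s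
      by (rule y_rest_zero) (use less that in auto)
    have y_eq: "y z t j = exp (cnj (J j j) * of_real t) * y z 0 j" for t
      using zero less.prems by (rule y_rest_exp)
    define K where "K = (\<Sum>k<n. (cmod (q k j))\<^sup>2)"
    have bd: "(cmod (y z 0 j))\<^sup>2 \<le> K * (\<Sum>k<n. (cmod (x z t k))\<^sup>2)" if "0 \<le> t" for t
    proof -
      have "1 * cmod (y z 0 j) \<le> exp (Re (J j j) * t) * cmod (y z 0 j)"
        using that J_rest less.prems by (intro mult_right_mono) auto
      also have "\<dots> = cmod (y z t j)"
        using arg_cong[OF y_eq[where t = t], of cmod] by (simp add: norm_mult)
      also have "\<dots> \<le> (\<Sum>k<n. cmod (q k j) * cmod (x z t k))"
        unfolding y_def by (rule order_trans[OF norm_sum]) (simp add: norm_mult)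
      finally have "(cmod (y z 0 j))\<^sup>2 \<le> (\<Sum>k<n. cmod (q k j) * cmod (x z t k))\<^sup>2"
        by (intro power_mono) auto
      also have "\<dots> \<le> K * (\<Sum>k<n. (cmod (x z t k))\<^sup>2)"
        unfolding K_def by (rule Cauchy_Schwarz_ineq_sum)
      finally show ?thesis .
    qed
    have K: "K \<ge> 0" unfolding K_def by (simp add: sum_nonneg)
    have "T * (cmod (y z 0 j))\<^sup>2 \<le> K * C" if T: "0 < T" for T
    proof -
      have "T * (cmod (y z 0 j))\<^sup>2 = integral {0..T} (\<lambda>t. (cmod (y z 0 j))\<^sup>2)"
        using T by simp
      also have "\<dots> \<le> integral {0..T} (\<lambda>t. K * (\<Sum>k<n. (cmod (x z t k))\<^sup>2))"
        by (intro integral_le integrable_continuous_interval continuous_intros continuous_x bd) auto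
      also have "\<dots> = K * (\<Sum>k<n. energy z T k)"
        unfolding energy_def by (subst integral_mult_right, subst integral_sum) (auto intro: integrable_x)
      also have "\<dots> \<le> K * C"
        using C[OF T] K by (rule mult_left_mono)
      finally show ?thesis .
    qed
    note bound = this
    show ?case
    proof (rule ccontr)
      assume "y z 0 j \<noteq> 0"
      then have pos: "(cmod (y z 0 j))\<^sup>2 > 0" by simp
      obtain T where T: "T > max 0 (K * C / (cmod (y z 0 j))\<^sup>2)" using gt_ex by blast
      then have "K * C < T * (cmod (y z 0 j))\<^sup>2"
        using pos by (simp add: pos_divide_less_eq)
      with bound[of T] T show False by simp
    qed
  qed
  then show ?thesis by (simp add: stable_def)
qed

lemma y_stable_deriv:
  assumes j: "j < m"
  shows "((\<lambda>t. y z t j) has_vector_derivative (\<Sum>a<m. cnj (J a j) * y z t a)) (at t)"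
proof -
  have "(\<Sum>a<n. cnj (J a j) * y z t a) = (\<Sum>a<m. cnj (J a j) * y z t a)"
    using m_le_n j by (intro sum.mono_neutral_right) (auto simp: J_upper)
  then show ?thesis using y_deriv[of j z t] m_le_n j by simp
qed

text \<open>Forward substitution: each component solves a scalar equation forced by the earlier
  ones, which already decay exponentially.\<close>

lemma y_decay:
  assumes "j < m"
  shows "((\<lambda>t. y z t j) \<longlongrightarrow> 0) at_top"
proof -
  \<comment> \<open>Half the smallest decay rate leaves the strict gap that
    \<open>forced_ode_decay\<close> asks for at every index, so one exponent survives all induction
    steps in spite of the polynomial factors of Jordan blocks.\<close>
  define b where "b = Min ((\<lambda>i. - Re (J i i)) ` {..<m}) / 2"
  have "Min ((\<lambda>i. - Re (J i i)) ` {..<m}) > 0"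
    using assms J_stable by (subst Min_gr_iff) auto
  then have b: "b > 0" by (simp add: b_def)
  have "b < - Re (J i i)" if "i < m" for i
  proof -
    have "2 * b \<le> - Re (J i i)" unfolding b_def using that by (simp add: Min_le)
    then show ?thesis using b by simp
  qed
  note b_lt = this
  have "\<exists>D. \<forall>t\<ge>0. cmod (y z t j) \<le> D * exp (- b * t)" if "j < m" for j
    using that
  proof (induction j rule: less_induct)
    case (less j)
    have "\<exists>D. \<forall>a<j. \<forall>t\<ge>0. cmod (y z t a) \<le> D a * exp (- b * t)"
      using less by (intro choice) (metis less_trans)
    then obtain D where D: "\<And>a t. a < j \<Longrightarrow> t \<ge> 0 \<Longrightarrow> cmod (y z t a) \<le> D a * exp (- b * t)"
      by blast
    show ?case
    proof (rule forced_ode_decay)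
      fix t
      have "(\<Sum>a<m. cnj (J a j) * y z t a) = (\<Sum>a<Suc j. cnj (J a j) * y z t a)"
        using less.prems m_le_n by (intro sum.mono_neutral_right) (auto simp: J_upper)
      then show "((\<lambda>t. y z t j) has_vector_derivative
          cnj (J j j) * y z t j + (\<Sum>a<j. cnj (J a j) * y z t a)) (at t)"
        using y_stable_deriv[OF less.prems, of z t] by (simp add: add.commute)
    next
      show "Re (cnj (J j j)) < - b" using b_lt[OF less.prems] by simp
    next
      fix t :: real assume t: "t \<ge> 0"
      have "cmod (\<Sum>a<j. cnj (J a j) * y z t a) \<le> (\<Sum>a<j. cmod (J a j) * (D a * exp (- b * t)))"
        using D t by (intro sum_norm_le) (auto simp: norm_mult intro!: mult_left_mono)
      then show "cmod (\<Sum>a<j. cnj (J a j) * y z t a) \<le> (\<Sum>a<j. cmod (J a j) * D a) * exp (- b * t)"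
        by (simp add: sum_distrib_right mult.assoc)
    qed
  qed
  then obtain D where D: "\<forall>t\<ge>0. cmod (y z t j) \<le> D * exp (- b * t)" using assms by blast
  have "((\<lambda>t. exp (- b * t)) \<longlongrightarrow> 0) at_top"
  proof (rule filterlim_compose[OF exp_at_bot])
    show "filterlim (\<lambda>t. - b * t) at_bot at_top"
      using b by (intro filterlim_tendsto_neg_mult_at_bot[OF tendsto_const]) (auto simp: filterlim_ident)
  qed
  then have "((\<lambda>t. D * exp (- b * t)) \<longlongrightarrow> 0) at_top"
    by (rule tendsto_mult_right_zero)
  then show ?thesis
    by (rule Lim_null_comparison[rotated]) (use D in \<open>auto intro: eventually_mono[OF eventually_ge_at_top[of 0]]\<close>)
qed

text \<open>The left side is the derivative of \<open>y^* W y\<close> along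
  \<open>y' = J^* y\<close>. The Lyapunov equation turns it into minus the form of the matrix with
  entries \<open>r i k * p k * cnj (r j k)\<close>, and this is a sum of squares of \<open>x\<close>
  because for stable \<open>z\<close> the expansion of \<open>x\<close> in \<open>y\<close> stops at
  \<open>m\<close>.\<close>

lemma sesq_lyapunov:
  assumes W: "lyapunov p W" and z: "stable z"
  shows "sesq m W (\<lambda>i. \<Sum>a<m. cnj (J a i) * y z t a) (y z t)
       + sesq m W (y z t) (\<lambda>i. \<Sum>a<m. cnj (J a i) * y z t a)
       = - of_real (\<Sum>k<n. p k * (cmod (x z t k))\<^sup>2)" (is "?L + ?R = _")
proof -
  let ?y = "y z t"
  have "?L = (\<Sum>j<m. \<Sum>i<m. \<Sum>a<m. J a i * cnj (?y a) * W i j * ?y j)"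
    unfolding sesq_def cnj_sum sum_distrib_left sum_distrib_right by (subst sum.swap) simp
  also have "\<dots> = (\<Sum>j<m. \<Sum>a<m. \<Sum>i<m. J a i * cnj (?y a) * W i j * ?y j)"
    by (intro sum.cong refl sum.swap)
  also have "\<dots> = sesq m (\<lambda>i j. \<Sum>a<m. J i a * W a j) ?y ?y"
    unfolding sesq_def sum_distrib_left sum_distrib_right by (subst sum.swap) (simp add: ac_simps)
  finally have L: "?L = sesq m (\<lambda>i j. \<Sum>a<m. J i a * W a j) ?y ?y" .
  have "?R = (\<Sum>i<m. \<Sum>j<m. \<Sum>a<m. cnj (?y i) * W i j * (cnj (J a j) * ?y a))"
    unfolding sesq_def sum_distrib_left ..
  also have "\<dots> = (\<Sum>i<m. \<Sum>a<m. \<Sum>j<m. cnj (?y i) * W i j * (cnj (J a j) * ?y a))"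
    by (intro sum.cong refl sum.swap)
  also have "\<dots> = sesq m (\<lambda>i j. \<Sum>a<m. W i a * cnj (J j a)) ?y ?y"
    unfolding sesq_def sum_distrib_left sum_distrib_right by (simp add: ac_simps)
  finally have R: "?R = sesq m (\<lambda>i j. \<Sum>a<m. W i a * cnj (J j a)) ?y ?y" .
  have "?L + ?R = sesq m (\<lambda>i j. (\<Sum>a<m. J i a * W a j) + (\<Sum>a<m. W i a * cnj (J j a))) ?y ?y"
    unfolding L R unfolding sesq_def sum.distrib[symmetric] by (simp add: algebra_simps)
  also have "\<dots> = sesq m (\<lambda>i j. - (\<Sum>k<n. r i k * of_real (p k) * cnj (r j k))) ?y ?y"
    using W unfolding lyapunov_def by (intro sesq_cong) (auto simp: eq_neg_iff_add_eq_0)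
  also have "\<dots> = - (\<Sum>i<m. \<Sum>j<m. \<Sum>k<n. cnj (?y i) * (r i k * of_real (p k) * cnj (r j k)) * ?y j)"
    unfolding sesq_def by (simp add: sum_distrib_left sum_distrib_right sum_negf)
  also have "(\<Sum>i<m. \<Sum>j<m. \<Sum>k<n. cnj (?y i) * (r i k * of_real (p k) * cnj (r j k)) * ?y j)
     = (\<Sum>i<m. \<Sum>k<n. \<Sum>j<m. cnj (?y i) * (r i k * of_real (p k) * cnj (r j k)) * ?y j)"
    by (intro sum.cong refl sum.swap)
  also have "\<dots> = (\<Sum>k<n. \<Sum>i<m. \<Sum>j<m. cnj (?y i) * (r i k * of_real (p k) * cnj (r j k)) * ?y j)"
    by (rule sum.swap)
  also have "\<dots> = (\<Sum>k<n. of_real (p k) *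
      ((\<Sum>j<m. cnj (r j k) * ?y j) * cnj (\<Sum>j<m. cnj (r j k) * ?y j)))"
    unfolding cnj_sum unfolding sum_product unfolding sum_distrib_left
    by (rule sum.cong, rule refl, subst sum.swap) (simp add: ac_simps)
  also have "\<dots> = (\<Sum>k<n. of_real (p k) * of_real ((cmod (x z t k))\<^sup>2))"
  proof (intro sum.cong refl)
    fix k assume k: "k \<in> {..<n}"
    have "(\<Sum>j<n. cnj (r j k) * ?y j) = (\<Sum>j<m. cnj (r j k) * ?y j)"
      using m_le_n stableD[OF z] by (intro sum.mono_neutral_right) auto
    then show "of_real (p k) * ((\<Sum>j<m. cnj (r j k) * ?y j) * cnj (\<Sum>j<m. cnj (r j k) * ?y j)) =
        (of_real (p k) * of_real ((cmod (x z t k))\<^sup>2) :: complex)"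
      using x_of_y[of k z t] k by (simp only: complex_norm_square) simp
  qed
  also have "\<dots> = of_real (\<Sum>k<n. p k * (cmod (x z t k))\<^sup>2)" by simp
  finally show ?thesis .
qed

lemma sesq_deriv:
  assumes "\<And>i. i < m \<Longrightarrow> ((\<lambda>t. f t i) has_vector_derivative f' i) (at t)"
  shows "((\<lambda>t. sesq m W (f t) (f t)) has_vector_derivative (sesq m W f' (f t) + sesq m W (f t) f')) (at t)"
proof -
  have "((\<lambda>t. sesq m W (f t) (f t)) has_vector_derivative
      (\<Sum>i<m. \<Sum>j<m. cnj (f t i) * W i j * f' j + cnj (f' i) * W i j * f t j)) (at t)"
    unfolding sesq_def
    by (intro has_vector_derivative_sum has_vector_derivative_mult has_vector_derivative_mult_left
        has_vector_derivative_cnj assms) auto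
  then show ?thesis unfolding sesq_def by (simp add: sum.distrib add.commute)
qed

lemma lyapunov_energy:
  assumes W: "lyapunov p W" and z: "stable z" and T: "0 \<le> T"
  shows "sesq m W (y z 0) (y z 0) - sesq m W (y z T) (y z T) = of_real (\<Sum>k<n. p k * energy z T k)"
proof -
  let ?h = "\<lambda>t. sesq m W (y z t) (y z t)"
  let ?e = "\<lambda>t. \<Sum>k<n. p k * (cmod (x z t k))\<^sup>2"
  have h: "(?h has_vector_derivative - of_real (?e t)) (at t)" for t
    unfolding sesq_lyapunov[OF W z, symmetric] by (rule sesq_deriv) (rule y_stable_deriv)
  have 1: "((\<lambda>t. - of_real (?e t)) has_integral ?h T - ?h 0) {0..T}"
    using T by (rule fundamental_theorem_of_calculus) (rule has_vector_derivative_at_within, rule h)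
  have "((\<lambda>t. ?e t) has_integral (\<Sum>k<n. p k * energy z T k)) {0..T}"
    unfolding energy_def
    by (intro has_integral_sum has_integral_mult_right integrable_integral integrable_x) auto
  then have "((\<lambda>t. - (of_real (?e t) :: complex)) has_integral - of_real (\<Sum>k<n. p k * energy z T k)) {0..T}"
    by (intro has_integral_neg has_integral_of_real)
  from has_integral_unique[OF 1 this] show ?thesis by (simp add: algebra_simps)
qed

lemma sesq_decay: "((\<lambda>t. sesq m W (y z t) (y z t)) \<longlongrightarrow> 0) at_top"
proof -
  have "((\<lambda>t. sesq m W (y z t) (y z t)) \<longlongrightarrow> (\<Sum>i<m. \<Sum>j<m. cnj 0 * W i j * 0)) at_top"
    unfolding sesq_def by (intro tendsto_intros y_decay) auto
  then show ?thesis by simp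
qed

text \<open>The terminal term of \<open>lyapunov_energy\<close> decays. Realness of the form comes
  for free as a limit of real numbers; symmetry of \<open>W\<close> is established only
  later.\<close>

lemma weighted_energy_tendsto:
  assumes W: "lyapunov p W" and z: "stable z"
  shows "((\<lambda>T. \<Sum>k<n. p k * energy z T k) \<longlongrightarrow> Re (sesq m W (y z 0) (y z 0))) at_top"
    and "Im (sesq m W (y z 0) (y z 0)) = 0"
proof -
  let ?h = "\<lambda>t. sesq m W (y z t) (y z t)"
  have "((\<lambda>T. ?h 0 - ?h T) \<longlongrightarrow> ?h 0 - 0) at_top"
    by (intro tendsto_diff tendsto_const sesq_decay)
  then have lim: "((\<lambda>T. of_real (\<Sum>k<n. p k * energy z T k)) \<longlongrightarrow> ?h 0) at_top"
    unfolding diff_zero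
    by (rule Lim_transform_eventually)
      (rule eventually_mono[OF eventually_ge_at_top[of 0]], rule lyapunov_energy[OF W z])
  show "((\<lambda>T. \<Sum>k<n. p k * energy z T k) \<longlongrightarrow> Re (?h 0)) at_top"
    using tendsto_Re[OF lim] by (simp del: of_real_sum)
  show "Im (?h 0) = 0"
    using tendsto_Im[OF lim] by (simp del: of_real_sum add: tendsto_const_iff)
qed

end

section \<open>The Lyapunov equation and the Gramian\<close>

text \<open>Back substitution from the bottom right corner: for upper triangular \<open>J\<close>
  the equation at \<open>(i, j)\<close> involves, besides \<open>W i j\<close>, only entries further
  down in column \<open>j\<close> or further right in row \<open>i\<close>.\<close>

function lyapunov_solution ::
  "nat \<Rightarrow> (nat \<Rightarrow> nat \<Rightarrow> complex) \<Rightarrow> (nat \<Rightarrow> nat \<Rightarrow> complex) \<Rightarrow> nat \<Rightarrow> nat \<Rightarrow> complex" where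
  "lyapunov_solution m J B i j =
     (if i < m \<and> j < m then
        - (B i j + (\<Sum>a\<in>{i<..<m}. J i a * lyapunov_solution m J B a j) +
           (\<Sum>a\<in>{j<..<m}. lyapunov_solution m J B i a * cnj (J j a))) / (J i i + cnj (J j j))
      else 0)"
  by pat_completeness auto
termination
  by (relation "Wellfounded.measure (\<lambda>(m, J, B, i, j). 2 * m - (i + j))") auto

declare lyapunov_solution.simps [simp del]

context triangular_flow
begin

lemma sum_upper_row:
  assumes "i < m"
  shows "(\<Sum>a<m. J i a * f a) = J i i * f i + (\<Sum>a\<in>{i<..<m}. J i a * f a)"
proof -
  have "(\<Sum>a<m. J i a * f a) = (\<Sum>a\<in>insert i {i<..<m}. J i a * f a)"
    using assms m_le_n J_upper by (intro sum.mono_neutral_right) (auto simp: not_less)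
  then show ?thesis by simp
qed

text \<open>Splitting off the diagonal coefficients gives exactly the recursion of
  \<open>lyapunov_solution\<close>, so existence and uniqueness both reduce to dividing by
  \<open>J i i + cnj (J j j)\<close>, whose real part is negative.\<close>

lemma lyapunov_iff:
  "lyapunov p W \<longleftrightarrow> (\<forall>i<m. \<forall>j<m. (J i i + cnj (J j j)) * W i j =
     - ((\<Sum>k<n. r i k * of_real (p k) * cnj (r j k)) + (\<Sum>a\<in>{i<..<m}. J i a * W a j) +
       (\<Sum>a\<in>{j<..<m}. W i a * cnj (J j a))))"
proof -
  have "(\<Sum>a<m. W i a * cnj (J j a)) = W i j * cnj (J j j) + (\<Sum>a\<in>{j<..<m}. W i a * cnj (J j a))"
    if "j < m" for i j
    using arg_cong[OF sum_upper_row[OF that, of "\<lambda>a. cnj (W i a)"], of cnj]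
    by (simp add: mult.commute)
  then show ?thesis
    unfolding lyapunov_def by (simp add: sum_upper_row eq_neg_iff_add_eq_0 algebra_simps)
qed

lemma J_diag_nonzero:
  assumes "i < m" "j < m"
  shows "J i i + cnj (J j j) \<noteq> 0"
  using J_stable[OF assms(1)] J_stable[OF assms(2)] by (auto simp: complex_eq_iff)

lemma lyapunov_exists:
  "lyapunov p (lyapunov_solution m J (\<lambda>i j. \<Sum>k<n. r i k * of_real (p k) * cnj (r j k)))"
  unfolding lyapunov_iff
proof (intro allI impI)
  fix i j assume ij: "i < m" "j < m"
  let ?B = "\<lambda>i j. \<Sum>k<n. r i k * of_real (p k) * cnj (r j k)"
  show "(J i i + cnj (J j j)) * lyapunov_solution m J ?B i j =
     - (?B i j + (\<Sum>a\<in>{i<..<m}. J i a * lyapunov_solution m J ?B a j) +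
       (\<Sum>a\<in>{j<..<m}. lyapunov_solution m J ?B i a * cnj (J j a)))"
    by (subst (1) lyapunov_solution.simps) (use ij J_diag_nonzero in simp)
qed

lemma lyapunov_unique:
  assumes W: "lyapunov p W" and W': "lyapunov p W'" and "i < m" "j < m"
  shows "W i j = W' i j"
  using assms(3,4)
proof (induction "2 * m - (i + j)" arbitrary: i j rule: less_induct)
  case less
  have "(J i i + cnj (J j j)) * W i j = (J i i + cnj (J j j)) * W' i j"
  proof -
    have "(\<Sum>a\<in>{i<..<m}. J i a * W a j) = (\<Sum>a\<in>{i<..<m}. J i a * W' a j)"
      using less by (intro sum.cong refl) (simp add: diff_less_mono2)
    moreover have "(\<Sum>a\<in>{j<..<m}. W i a * cnj (J j a)) = (\<Sum>a\<in>{j<..<m}. W' i a * cnj (J j a))"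
      using less by (intro sum.cong refl) (simp add: diff_less_mono2)
    ultimately show ?thesis
      using W W' less.prems unfolding lyapunov_iff by simp
  qed
  then show ?case using J_diag_nonzero less.prems by simp
qed

text \<open>For real \<open>p\<close> the conjugate transpose of a solution solves the same
  equation, so uniqueness applies.\<close>

lemma lyapunov_hermitian:
  assumes W: "lyapunov p W" and "i < m" "j < m"
  shows "W j i = cnj (W i j)"
proof -
  have "lyapunov p (\<lambda>i j. cnj (W j i))"
    unfolding lyapunov_def
  proof (intro allI impI)
    fix i j assume "i < m" "j < m"
    then have "(\<Sum>a<m. J j a * W a i) + (\<Sum>a<m. W j a * cnj (J i a)) +
     (\<Sum>k<n. r j k * of_real (p k) * cnj (r i k)) = 0"
      using W by (simp add: lyapunov_def)
    from arg_cong[OF this, of cnj]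
    show "(\<Sum>a<m. J i a * cnj (W j a)) + (\<Sum>a<m. cnj (W a i) * cnj (J j a)) +
      (\<Sum>k<n. r i k * of_real (p k) * cnj (r j k)) = 0"
      by (simp add: ac_simps)
  qed
  from lyapunov_unique[OF W this assms(3,2)] show ?thesis .
qed

text \<open>\<open>Q^-*\<close> applied to \<open>v\<close> padded with zeros: the parametrization
  of the stable subspace by its coordinates in the stable block.\<close>

definition lift :: "(nat \<Rightarrow> complex) \<Rightarrow> nat \<Rightarrow> complex" where
  "lift v k = (\<Sum>j<m. cnj (r j k) * v j)"

lemma y_lift:
  assumes "j < n"
  shows "y (lift v) 0 j = (if j < m then v j else 0)"
proof -
  have "y (lift v) 0 j = (\<Sum>k<n. cnj (q k j) * lift v k)"
    unfolding y_def by (simp add: x_0)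
  also have "\<dots> = (\<Sum>i<m. cnj (\<Sum>k<n. r i k * q k j) * v i)"
    unfolding lift_def cnj_sum sum_distrib_left sum_distrib_right
    by (subst sum.swap) (simp add: ac_simps)
  also have "\<dots> = (\<Sum>i<m. if i = j then v i else 0)"
    using assms m_le_n by (intro sum.cong refl) (auto simp: rq)
  finally show ?thesis by simp
qed

lemma stable_lift: "stable (lift v)"
  by (simp add: stable_def y_lift)

lemma sesq_y_lift: "sesq m W (y (lift v) 0) (y (lift v) 0) = sesq m W v v"
  using m_le_n by (intro sesq_cong) (auto simp: y_lift)

text \<open>Energy on the infinite horizon, taken as a limit so that no improper integral is needed;
  it does not involve \<open>p\<close>.\<close>

definition total_energy :: "(nat \<Rightarrow> complex) \<Rightarrow> nat \<Rightarrow> real" where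
  "total_energy v k = (THE a. ((\<lambda>T. energy (lift v) T k) \<longlongrightarrow> a) at_top)"

lemma energy_tendsto:
  assumes k: "k < n"
  shows "((\<lambda>T. energy (lift v) T k) \<longlongrightarrow> total_energy v k) at_top"
proof -
  \<comment> \<open>With the \<open>k\<close>-th unit vector as weight, the weighted energy is the
    energy of coordinate \<open>k\<close> alone, so its convergence is an instance of
    \<open>weighted_energy_tendsto\<close>.\<close>
  obtain W where W: "lyapunov (\<lambda>i. if i = k then 1 else 0) W" using lyapunov_exists by blast
  have "(\<Sum>i<n. (if i = k then 1 else 0) * energy (lift v) T i) = energy (lift v) T k" for T
    using k by (subst sum.cong[OF refl, of _ _ "\<lambda>i. if i = k then energy (lift v) T i else 0"]) auto
  with weighted_energy_tendsto(1)[OF W stable_lift, of v]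
  have lim: "((\<lambda>T. energy (lift v) T k) \<longlongrightarrow> Re (sesq m W v v)) at_top"
    by (simp add: sesq_y_lift)
  show ?thesis
    unfolding total_energy_def
    by (rule theI, rule lim, erule tendsto_unique[OF trivial_limit_at_top_linorder _ lim])
qed

lemma energy_le_total: "k < n \<Longrightarrow> energy (lift v) T k \<le> total_energy v k"
  by (rule tendsto_lowerbound[OF energy_tendsto])
    (auto intro: eventually_mono[OF eventually_ge_at_top[of T]] energy_mono)

lemma total_energy_nonneg: "k < n \<Longrightarrow> 0 \<le> total_energy v k"
  using energy_le_total[of k v 0] energy_nonneg[of "lift v" 0 k] by linarith

text \<open>Makes the dependence on \<open>p\<close> explicit: for fixed \<open>v\<close> the form
  is linear in \<open>p\<close> with nonnegative coefficients. Semidefiniteness, passage to limits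
  and comparison of different \<open>p\<close> are all read off from here.\<close>

lemma sesq_eq_total_energy:
  assumes W: "lyapunov p W"
  shows "sesq m W v v = of_real (\<Sum>k<n. p k * total_energy v k)"
proof -
  have "((\<lambda>T. \<Sum>k<n. p k * energy (lift v) T k) \<longlongrightarrow> (\<Sum>k<n. p k * total_energy v k)) at_top"
    by (intro tendsto_intros energy_tendsto) auto
  with weighted_energy_tendsto(1)[OF W stable_lift, of v]
  have "Re (sesq m W v v) = (\<Sum>k<n. p k * total_energy v k)"
    unfolding sesq_y_lift by (rule tendsto_unique[OF trivial_limit_at_top_linorder])
  moreover have "Im (sesq m W v v) = 0"
    using weighted_energy_tendsto(2)[OF W stable_lift, of v] unfolding sesq_y_lift .
  ultimately show ?thesis by (simp add: complex_eq_iff)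
qed

lemma lyapunov_psd:
  assumes "lyapunov p W" "\<And>k. k < n \<Longrightarrow> 0 \<le> p k"
  shows "0 \<le> Re (sesq m W v v)"
  unfolding sesq_eq_total_energy[OF assms(1)] Re_complex_of_real
  by (intro sum_nonneg mult_nonneg_nonneg total_energy_nonneg assms(2)) auto

section \<open>The finite-horizon Gramian as a weighted energy\<close>

definition gram :: "(nat \<Rightarrow> real) \<Rightarrow> real \<Rightarrow> nat \<Rightarrow> nat \<Rightarrow> real" where
  "gram p T i j = (\<Sum>k<n. p k * integral {0..T} (\<lambda>t. E t i k * E t j k))"

lemma gram_sym: "gram p T i j = gram p T j i"
  unfolding gram_def by (simp add: mult.commute)

lemma continuous_E: "i < n \<Longrightarrow> j < n \<Longrightarrow> continuous_on S (\<lambda>t. E t i j)"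
  by (rule DERIV_continuous_on) (rule has_field_derivative_at_within, rule E_deriv)

lemma integrable_EE:
  "i < n \<Longrightarrow> j < n \<Longrightarrow> k < n \<Longrightarrow> (\<lambda>t. E t i k * E t j k) integrable_on {a..b}"
  by (intro integrable_continuous_interval continuous_intros continuous_E)

lemma energy_eq_sesq:
  assumes k: "k < n"
  shows "of_real (energy z T k) = sesq n (\<lambda>i j. of_real (integral {0..T} (\<lambda>t. E t i k * E t j k))) z z"
proof -
  have "((\<lambda>t. of_real ((cmod (x z t k))\<^sup>2)) has_integral (of_real (energy z T k) :: complex)) {0..T}"
    unfolding energy_def using k by (intro has_integral_of_real integrable_integral integrable_x)
  moreover have "of_real ((cmod (x z t k))\<^sup>2) =
    (\<Sum>i<n. \<Sum>j<n. cnj (z i) * of_real (E t i k * E t j k) * z j)" for t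
  proof -
    have "of_real ((cmod (x z t k))\<^sup>2) = cnj (x z t k) * x z t k"
      by (simp add: complex_norm_square mult.commute del: of_real_power)
    then show ?thesis
      unfolding x_def cnj_sum unfolding sum_product by (simp add: ac_simps)
  qed
  moreover have "((\<lambda>t. \<Sum>i<n. \<Sum>j<n. cnj (z i) * of_real (E t i k * E t j k) * z j) has_integral
    sesq n (\<lambda>i j. of_real (integral {0..T} (\<lambda>t. E t i k * E t j k))) z z) {0..T}"
    unfolding sesq_def using k
    by (intro has_integral_sum has_integral_mult_left has_integral_mult_right has_integral_of_real
        integrable_integral integrable_EE) auto
  ultimately show ?thesis by (simp add: has_integral_unique)
qed

text \<open>The finite-horizon counterpart of \<open>sesq_eq_total_energy\<close>, valid for all
  \<open>z\<close> and not only for stable ones.\<close>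

lemma sesq_gram:
  "sesq n (\<lambda>i j. of_real (gram p T i j)) z z = of_real (\<Sum>k<n. p k * energy z T k)"
proof -
  have "of_real (\<Sum>k<n. p k * energy z T k) =
    (\<Sum>k<n. \<Sum>i<n. \<Sum>j<n. cnj (z i) * of_real (p k * integral {0..T} (\<lambda>t. E t i k * E t j k)) * z j)"
    unfolding of_real_sum of_real_mult
    by (intro sum.cong refl, subst energy_eq_sesq)
      (auto simp: sesq_def sum_distrib_left ac_simps)
  also have "\<dots> =
    (\<Sum>i<n. \<Sum>k<n. \<Sum>j<n. cnj (z i) * of_real (p k * integral {0..T} (\<lambda>t. E t i k * E t j k)) * z j)"
    by (rule sum.swap)
  also have "\<dots> =
    (\<Sum>i<n. \<Sum>j<n. \<Sum>k<n. cnj (z i) * of_real (p k * integral {0..T} (\<lambda>t. E t i k * E t j k)) * z j)"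
    by (rule sum.cong, rule refl, rule sum.swap)
  also have "\<dots> = sesq n (\<lambda>i j. of_real (gram p T i j)) z z"
    unfolding sesq_def gram_def of_real_sum sum_distrib_left sum_distrib_right ..
  finally show ?thesis by simp
qed

text \<open>A vanishing energy in coordinate \<open>i\<close> forces that coordinate of the
  trajectory to be zero on the whole interval, in particular at time 0, where it equals
  \<open>z i\<close>.\<close>

lemma energy_pos:
  assumes p: "\<And>k. k < n \<Longrightarrow> 0 < p k" and T: "0 < T" and z: "i < n" "z i \<noteq> 0"
  shows "0 < (\<Sum>k<n. p k * energy z T k)"
proof -
  have "energy z T i \<noteq> 0"
  proof
    assume "energy z T i = 0"
    then have "\<forall>t\<in>{0..T}. (cmod (x z t i))\<^sup>2 = 0"
      unfolding energy_def using T z(1)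
      by (subst (asm) integral_eq_0_iff) (auto intro!: continuous_intros continuous_x)
    then have "x z 0 i = 0" using T by auto
    then show False using z by (simp add: x_0)
  qed
  then have "0 < p i * energy z T i"
    using p[OF z(1)] energy_nonneg[of z T i] by simp
  also have "\<dots> \<le> (\<Sum>k<n. p k * energy z T k)"
    using z(1) p energy_nonneg by (intro member_le_sum) (auto simp: less_imp_le)
  finally show ?thesis .
qed

text \<open>\<open>psd_dual_bound\<close> for the \<open>i\<close>-th unit vector: \<open>V\<close>
  is column \<open>i\<close> of the inverse Gramian, so the dual value is its diagonal
  entry.\<close>

lemma gram_dual_bound:
  assumes p: "\<And>k. k < n \<Longrightarrow> 0 \<le> p k"
    and V: "\<And>j. j < n \<Longrightarrow> (\<Sum>k<n. gram p T j k * V k) = (if j = i then 1 else 0)"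
    and i: "i < n"
  shows "2 * Re (v i) - (\<Sum>k<n. p k * energy v T k) \<le> V i"
proof -
  have "2 * Re (\<Sum>j<n. cnj (if j = i then 1 else 0) * v j) -
      Re (sesq n (\<lambda>i j. of_real (gram p T i j)) v v)
    \<le> Re (\<Sum>j<n. cnj (if j = i then 1 else 0) * of_real (V j))"
  proof (rule psd_dual_bound)
    show "0 \<le> Re (sesq n (\<lambda>i j. of_real (gram p T i j)) z z)" for z
      unfolding sesq_gram Re_complex_of_real
      by (intro sum_nonneg mult_nonneg_nonneg energy_nonneg p) auto
    show "(\<Sum>k<n. complex_of_real (gram p T j k) * of_real (V k)) = (if j = i then 1 else 0)"
      if "j < n" for j
      using V[OF that] unfolding of_real_mult[symmetric] of_real_sum[symmetric] by simp
  qed (simp add: gram_sym)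
  moreover have "(\<Sum>j<n. cnj (if j = i then 1 else 0) * f j) = f i" for f :: "nat \<Rightarrow> complex"
    using i by (subst sum.cong[OF refl, of _ _ "\<lambda>j. if j = i then f j else 0"]) auto
  ultimately show ?thesis by (simp add: sesq_gram)
qed

lemma gram_self:
  assumes V: "\<And>j. j < n \<Longrightarrow> (\<Sum>k<n. gram p T j k * V k) = (if j = i then 1 else 0)"
    and i: "i < n"
  shows "(\<Sum>k<n. p k * energy (\<lambda>j. of_real (V j)) T k) = V i"
proof -
  let ?w = "\<lambda>j. complex_of_real (V j)"
  have "sesq n (\<lambda>i j. of_real (gram p T i j)) ?w ?w = (\<Sum>j<n. cnj (?w j) * (if j = i then 1 else 0))"
  proof (rule sesq_apply)
    show "(\<Sum>k<n. complex_of_real (gram p T j k) * of_real (V k)) = (if j = i then 1 else 0)"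
      if "j < n" for j
      using V[OF that] unfolding of_real_mult[symmetric] of_real_sum[symmetric] by simp
  qed
  also have "\<dots> = of_real (V i)"
    using i by (subst sum.cong[OF refl, of _ _ "\<lambda>j. if j = i then ?w j else 0"]) auto
  finally show ?thesis unfolding sesq_gram of_real_eq_iff .
qed

text \<open>The test vector is \<open>lift v\<close>: its energy up to \<open>T\<close> never
  exceeds its total energy, and its \<open>i\<close>-th coordinate is the pairing of
  \<open>v\<close> with the column of \<open>r\<close>. The bound is thus independent of
  \<open>T\<close>, and \<open>W\<close> may be singular.\<close>

lemma gram_inverse_lower_bound:
  assumes p: "\<And>k. k < n \<Longrightarrow> 0 \<le> p k" and W: "lyapunov p W"
    and V: "\<And>j. j < n \<Longrightarrow> (\<Sum>k<n. gram p T j k * V k) = (if j = i then 1 else 0)"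
    and i: "i < n"
  shows "2 * Re (\<Sum>a<m. cnj (r a i) * v a) - Re (sesq m W v v) \<le> V i"
proof -
  have "(\<Sum>k<n. p k * energy (lift v) T k) \<le> Re (sesq m W v v)"
    using p by (simp add: sesq_eq_total_energy[OF W]) (intro sum_mono mult_left_mono energy_le_total, auto)
  with gram_dual_bound[OF p V i, of "lift v"] show ?thesis
    by (simp add: lift_def)
qed

text \<open>
  The columns \<open>V T = W(T)\<^sup>-\<^sup>1 e\<^sub>i\<close> stay bounded. Every limit point has finite energy on
  \<open>[0, \<infinity>)\<close>, hence is stable, and the dual bound for \<open>W\<close> applies to it.
\<close>

lemma gram_inverse_upper_bound:
  assumes p: "\<And>k. k < n \<Longrightarrow> 0 < p k" and W: "lyapunov p W"
    and u: "\<And>a. a < m \<Longrightarrow> (\<Sum>b<m. W a b * u b) = r a i"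
    and V: "\<And>T i j. 0 < T \<Longrightarrow> i < n \<Longrightarrow> j < n \<Longrightarrow>
      (\<Sum>k<n. gram p T j k * V T k i) = (if j = i then 1 else 0)"
    and i: "i < n" and d: "0 < d"
  shows "\<forall>\<^sub>F T in at_top. V T i i \<le> Re (\<Sum>a<m. cnj (r a i) * u a) + d"
proof -
  let ?w = "\<lambda>T i j. complex_of_real (V T j i)"
  let ?Q = "\<lambda>T z. \<Sum>k<n. p k * energy z T k"
  have p': "\<And>k. k < n \<Longrightarrow> 0 \<le> p k" using p less_imp_le by blast
  have dual: "2 * Re (v j) - ?Q T v \<le> V T j j" if "0 < T" "j < n" for T j v
    by (rule gram_dual_bound[OF p' V[OF that] that(2)])
  have Q_mono: "?Q S z \<le> ?Q T z" if "S \<le> T" for S T z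
    using that p' by (intro sum_mono mult_left_mono energy_mono) auto
  have Q_le: "?Q S (?w T i) \<le> V T i i" if "0 < S" "S \<le> T" for S T
    using gram_self[OF V[of T i] i] Q_mono[OF that(2), of "?w T i"] that i by auto
  \<comment> \<open>The column at horizon \<open>T\<close> serves as test vector at the shorter
    horizon \<open>S\<close>, so diagonal entries of the inverse decrease with the horizon.\<close>
  have dec: "V T i i \<le> V S i i" if "0 < S" "S \<le> T" for S T
    using dual[OF that(1) i, of "?w T i"] Q_le[OF that] by simp
  \<comment> \<open>Off-diagonal entries are controlled by testing the bound at horizon 1 with the
    column and with its negative.\<close>
  have bd: "\<bar>V T j i\<bar> \<le> V 1 j j + V 1 i i" if "1 \<le> T" "j < n" for T j
  proof -
    have 1: "?Q 1 (?w T i) \<le> V 1 i i" using Q_le[of 1 T] dec[of 1 T] that by simp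
    moreover have "?Q 1 (\<lambda>j. - ?w T i j) = ?Q 1 (?w T i)"
      unfolding of_real_eq_iff[symmetric, where 'a = complex] sesq_gram[symmetric] by (rule sesq_uminus)
    moreover have "0 \<le> ?Q 1 (?w T i)" using p' by (intro sum_nonneg mult_nonneg_nonneg energy_nonneg) auto
    moreover have "2 * V T j i - ?Q 1 (?w T i) \<le> V 1 j j"
      "2 * (- V T j i) - ?Q 1 (\<lambda>j. - ?w T i j) \<le> V 1 j j"
      using dual[of 1 j "?w T i"] dual[of 1 j "\<lambda>j. - ?w T i j"] that by auto
    moreover have "0 \<le> V 1 j j"
    proof -
      have "V 1 j j = ?Q 1 (?w 1 j)"
        using gram_self[OF V[of 1 j]] that by simp
      also have "0 \<le> \<dots>" using p' by (intro sum_nonneg mult_nonneg_nonneg energy_nonneg) auto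
      finally show ?thesis .
    qed
    ultimately show ?thesis by linarith
  qed
  let ?T = "\<lambda>k. real (Suc k)"
  have "\<exists>C. \<forall>k. \<bar>V (?T k) j i\<bar> \<le> C" if "j < n" for j
    using bd[OF _ that] by (intro exI[of _ "V 1 j j + V 1 i i"]) auto
  then obtain s l where s: "strict_mono s" and l: "\<And>j. j < n \<Longrightarrow> (\<lambda>k. V (?T (s k)) j i) \<longlonglongrightarrow> l j"
    using bounded_seq_subseq_convergent[of n "\<lambda>k j. V (?T k) j i"] by blast
  define z where "z = (\<lambda>j. complex_of_real (l j))"
  \<comment> \<open>For fixed \<open>S\<close> the form is continuous in its finitely many
    arguments, so \<open>Q_le\<close> survives the limit although the horizon of the columns
    grows.\<close>
  have Q_z: "?Q S z \<le> l i" if S: "0 < S" for S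
  proof (rule LIMSEQ_le)
    show "(\<lambda>k. V (?T (s k)) i i) \<longlonglongrightarrow> l i" using l[OF i] .
    have "(\<lambda>k. sesq n (\<lambda>i j. of_real (gram p S i j)) (?w (?T (s k)) i) (?w (?T (s k)) i))
      \<longlonglongrightarrow> sesq n (\<lambda>i j. of_real (gram p S i j)) z z"
      unfolding sesq_def z_def by (intro tendsto_intros tendsto_cnj tendsto_of_real l) auto
    then show "(\<lambda>k. ?Q S (?w (?T (s k)) i)) \<longlonglongrightarrow> ?Q S z"
      unfolding sesq_gram by (rule tendsto_of_real_iff[THEN iffD1])
    obtain N :: nat where N: "S \<le> real N" using real_arch_simple by blast
    have "?Q S (?w (?T (s k)) i) \<le> V (?T (s k)) i i" if "N \<le> k" for k
    proof -
      have "S \<le> ?T (s k)" using N that seq_suble[OF s, of k] by linarith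
      then show ?thesis by (rule Q_le[OF S])
    qed
    then show "\<exists>N. \<forall>k\<ge>N. ?Q S (?w (?T (s k)) i) \<le> V (?T (s k)) i i" by blast
  qed
  have stable: "stable z"
  proof (rule stable_of_bounded_energy)
    fix T :: real assume T: "0 < T"
    show "(\<Sum>k<n. energy z T k) \<le> (\<Sum>k<n. l i / p k)"
    proof (rule sum_mono)
      fix k assume "k \<in> {..<n}"
      then have k: "k < n" by simp
      then have "p k * energy z T k \<le> ?Q T z"
        using p' energy_nonneg by (intro member_le_sum) auto
      also have "\<dots> \<le> l i" by (rule Q_z[OF T])
      finally show "energy z T k \<le> l i / p k"
        using p[OF k] by (simp add: field_simps)
    qed
  qed
  have "Re (sesq m W (y z 0) (y z 0)) \<le> l i"
    by (rule tendsto_upperbound[OF weighted_energy_tendsto(1)[OF W stable]])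
      (auto intro: eventually_mono[OF eventually_gt_at_top[of 0]] Q_z)
  moreover have "2 * Re (\<Sum>a<m. cnj (r a i) * y z 0 a) - Re (sesq m W (y z 0) (y z 0))
      \<le> Re (\<Sum>a<m. cnj (r a i) * u a)"
    by (rule psd_dual_bound[OF lyapunov_hermitian[OF W] lyapunov_psd[OF W p'] u])
  moreover have "(\<Sum>a<m. cnj (r a i) * y z 0 a) = of_real (l i)"
  proof -
    have "(\<Sum>a<m. cnj (r a i) * y z 0 a) = (\<Sum>a<n. cnj (r a i) * y z 0 a)"
      using m_le_n stableD[OF stable] by (intro sum.mono_neutral_left) auto
    also have "\<dots> = z i" using x_of_y[OF i, of z 0] x_0[OF i] by simp
    finally show ?thesis by (simp add: z_def)
  qed
  \<comment> \<open>Write \<open>h\<close> for the form at \<open>y z 0\<close> and \<open>c\<close>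
    for the dual value: \<open>2 * l i - h \<le> c\<close> and \<open>h \<le> l i\<close> together
    give \<open>l i \<le> c\<close>.\<close>
  ultimately have "l i < Re (\<Sum>a<m. cnj (r a i) * u a) + d" using d by simp
  then have "\<forall>\<^sub>F k in sequentially. V (?T (s k)) i i < Re (\<Sum>a<m. cnj (r a i) * u a) + d"
    by (rule order_tendstoD(2)[OF l[OF i]])
  then obtain k where k: "V (?T (s k)) i i < Re (\<Sum>a<m. cnj (r a i) * u a) + d"
    using eventually_happens by force
  \<comment> \<open>By monotonicity \<open>dec\<close>, one good horizon settles all later
    ones.\<close>
  show ?thesis
    by (rule eventually_mono[OF eventually_ge_at_top[of "?T (s k)"]])
      (use k dec[of "?T (s k)"] in force)
qed

end

section \<open>Matrices\<close>

lemma index_mult_mat_sum: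
  assumes "X \<in> carrier_mat k l" "Y \<in> carrier_mat l h" "i < k" "j < h"
  shows "(X * Y) $$ (i, j) = (\<Sum>a<l. X $$ (i, a) * Y $$ (a, j))"
  using assms by (simp add: scalar_prod_def lessThan_atLeast0)

lemma index_mat_adjoint [simp]:
  "i < dim_col X \<Longrightarrow> j < dim_row X \<Longrightarrow> mat_adjoint X $$ (i, j) = conjugate (X $$ (j, i))"
  unfolding mat_adjoint_def by (subst mat_of_rows_index) auto

lemma dim_mat_adjoint [simp]:
  "dim_row (mat_adjoint X) = dim_col X" "dim_col (mat_adjoint X) = dim_row X"
  unfolding mat_adjoint_def by simp_all

lemma mat_adjoint_carrier: "X \<in> carrier_mat k l \<Longrightarrow> mat_adjoint X \<in> carrier_mat l k"
  by (rule carrier_matI) (simp_all only: dim_mat_adjoint carrier_matD)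

lemma mat_inv_pos_def:
  assumes X: "X \<in> carrier_mat k k" and pd: "pos_def X"
  shows "mat_inv X \<in> carrier_mat k k" "X * mat_inv X = 1\<^sub>m k"
proof -
  have "det X \<noteq> 0"
  proof
    assume "det X = 0"
    then obtain v where v: "v \<in> carrier_vec k" "v \<noteq> 0\<^sub>v k" "X *\<^sub>v v = 0\<^sub>v k"
      using det_0_iff_vec_prod_zero_field[OF X] by auto
    then have "0 < (X *\<^sub>v v) \<bullet>c v" using pd X by (auto simp: pos_def_def)
    then show False using v by simp
  qed
  from det_non_zero_imp_unit[OF X this] obtain Y where "mat_inverse X = Some Y"
    using mat_inverse(1)[OF X] by fastforce
  with mat_inverse(2)[OF X this] show "mat_inv X \<in> carrier_mat k k" "X * mat_inv X = 1\<^sub>m k"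
    by (auto simp: mat_inv_def)
qed

text \<open>The order on complex numbers demands a real positive value; for Hermitian
  \<open>W\<close> the imaginary part of the form vanishes, so the real part decides.\<close>

lemma pos_def_complex_iff:
  fixes W :: "nat \<Rightarrow> nat \<Rightarrow> complex"
  assumes herm: "\<And>i j. i < k \<Longrightarrow> j < k \<Longrightarrow> W j i = cnj (W i j)"
  shows "pos_def (Matrix.mat k k (\<lambda>(i, j). W i j)) \<longleftrightarrow>
    (\<forall>v. (\<exists>i<k. v i \<noteq> 0) \<longrightarrow> 0 < Re (sesq k W v v))"
proof -
  let ?X = "Matrix.mat k k (\<lambda>(i, j). W i j)"
  have adj: "mat_adjoint ?X = ?X"
    by (intro eq_matI) (simp_all add: conjugate_complex_def herm[symmetric])
  have form: "(?X *\<^sub>v v) \<bullet>c v = sesq k W (\<lambda>i. v $ i) (\<lambda>i. v $ i)" if "v \<in> carrier_vec k" for v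
    using that unfolding sesq_def
    by (simp add: scalar_prod_def lessThan_atLeast0 sum_distrib_right sum_distrib_left
        conjugate_complex_def ac_simps)
  have im: "Im (sesq k W z z) = 0" for z
  proof -
    have "sesq k W z z = cnj (sesq k W z z)" using herm by (rule sesq_hermitian)
    then show ?thesis by (simp add: complex_eq_iff)
  qed
  have "(\<forall>v \<in> carrier_vec k. v \<noteq> 0\<^sub>v k \<longrightarrow> 0 < (?X *\<^sub>v v) \<bullet>c v) \<longleftrightarrow>
    (\<forall>v. (\<exists>i<k. v i \<noteq> 0) \<longrightarrow> 0 < Re (sesq k W v v))"
  proof (intro iffI allI impI ballI)
    fix v :: "nat \<Rightarrow> complex"
    assume l: "\<forall>v \<in> carrier_vec k. v \<noteq> 0\<^sub>v k \<longrightarrow> 0 < (?X *\<^sub>v v) \<bullet>c v" and v: "\<exists>i<k. v i \<noteq> 0"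
    have "Matrix.vec k v \<in> carrier_vec k" "Matrix.vec k v \<noteq> 0\<^sub>v k"
      using v by (auto simp: vec_eq_iff)
    with l form[of "Matrix.vec k v"]
    have "0 < sesq k W (\<lambda>i. Matrix.vec k v $ i) (\<lambda>i. Matrix.vec k v $ i)" by auto
    also have "\<dots> = sesq k W v v" by (intro sesq_cong) auto
    finally show "0 < Re (sesq k W v v)" by (simp add: less_complex_def)
  next
    fix v :: "complex Matrix.vec"
    assume r: "\<forall>v. (\<exists>i<k. v i \<noteq> 0) \<longrightarrow> 0 < Re (sesq k W v v)" and v: "v \<in> carrier_vec k" "v \<noteq> 0\<^sub>v k"
    then have "\<exists>i<k. v $ i \<noteq> 0" by (auto simp: vec_eq_iff)
    with r have "0 < Re (sesq k W (\<lambda>i. v $ i) (\<lambda>i. v $ i))" by blast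
    then show "0 < (?X *\<^sub>v v) \<bullet>c v" by (simp add: form[OF v(1)] im less_complex_def)
  qed
  then show ?thesis by (simp add: pos_def_def adj)
qed

lemma jordan_matrix_append_index:
  assumes "i < blocks_size (as @ bs)" "j < blocks_size (as @ bs)"
  shows "jordan_matrix (as @ bs) $$ (i, j) =
    (if i < blocks_size as then if j < blocks_size as then jordan_matrix as $$ (i, j) else 0
     else if j < blocks_size as then 0
     else jordan_matrix bs $$ (i - blocks_size as, j - blocks_size as))"
  using assms unfolding blocks_size_def jordan_matrix_def map_append diag_block_mat_append Let_def
  by (auto simp: dim_diag_block_mat o_def case_prod_unfold)

lemma jordan_matrix_diag:
  "i < blocks_size bs \<Longrightarrow> \<exists>(k, l) \<in> set bs. jordan_matrix bs $$ (i, i) = l"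
proof (induction bs arbitrary: i)
  case Nil
  then show ?case by (simp add: blocks_size_def)
next
  case (Cons b bs)
  obtain k l where b: "b = (k, l)" by (cases b)
  show ?case
  proof (cases "i < k")
    case True
    then have "jordan_matrix (b # bs) $$ (i, i) = l"
      using Cons.prems unfolding b jordan_matrix_Cons by (simp add: blocks_size_def)
    then show ?thesis by (auto simp: b)
  next
    case False
    then have "jordan_matrix (b # bs) $$ (i, i) = jordan_matrix bs $$ (i - k, i - k)"
      using Cons.prems unfolding b jordan_matrix_Cons by (simp add: blocks_size_def b)
    moreover have "i - k < blocks_size bs" using Cons.prems False by (simp add: blocks_size_def b)
    ultimately show ?thesis using Cons.IH by fastforce
  qed
qed

lemma pow_mat_smult:
  assumes "(X :: real Matrix.mat) \<in> carrier_mat n n"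
  shows "(t \<cdot>\<^sub>m X) ^\<^sub>m k = t ^ k \<cdot>\<^sub>m (X ^\<^sub>m k)"
proof (induction k)
  case (Suc k)
  have "X ^\<^sub>m k \<in> carrier_mat n n" using assms by (rule pow_carrier_mat)
  moreover have "a \<cdot>\<^sub>m (b \<cdot>\<^sub>m Y) = (a * b) \<cdot>\<^sub>m Y" for a b and Y :: "real Matrix.mat"
    by (intro eq_matI) auto
  ultimately show ?case using Suc assms
    by (simp add: mult_smult_assoc_mat[of _ n n _ n] mult_smult_distrib[of _ n n _ n]
        mult.commute)
qed (use assms in auto)

lemma pow_mat_transpose:
  assumes X: "(X :: real Matrix.mat) \<in> carrier_mat n n"
  shows "(transpose_mat X) ^\<^sub>m k = transpose_mat (X ^\<^sub>m k)"
proof (induction k)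
  case (Suc k)
  have Xk: "X ^\<^sub>m k \<in> carrier_mat n n" for k using X by (rule pow_carrier_mat)
  \<comment> \<open>Powers multiply on the right while transposition reverses the product, so
    \<open>X\<close> has to be moved past its own power.\<close>
  have comm: "X * X ^\<^sub>m k = X ^\<^sub>m k * X" for k
  proof (induction k)
    case (Suc k)
    have "X * (X ^\<^sub>m k * X) = (X * X ^\<^sub>m k) * X"
      by (rule assoc_mult_mat[OF X Xk X, symmetric])
    then show ?case using Suc by simp
  qed (use X in auto)
  have "transpose_mat X ^\<^sub>m Suc k = transpose_mat (X * X ^\<^sub>m k)"
    using Suc by (simp add: transpose_mult[OF X Xk])
  then show ?case by (simp add: comm)
qed (use X in auto)

section \<open>The entrywise matrix exponential\<close>

context
  fixes A :: "real Matrix.mat" and n :: nat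
  assumes A: "A \<in> carrier_mat n n"
begin

text \<open>A crude geometric bound, with \<open>K\<close> equal to \<open>n\<close> times the sum
  of all absolute entries; it lets the scalar exponential series dominate every entry.\<close>

lemma pow_mat_entry_bound:
  "\<exists>K. \<forall>k. \<forall>i<n. \<forall>j<n. \<bar>(A ^\<^sub>m k) $$ (i, j)\<bar> \<le> K ^ k"
proof -
  define M where "M = (\<Sum>i<n. \<Sum>j<n. \<bar>A $$ (i, j)\<bar>)"
  have M: "\<bar>A $$ (i, j)\<bar> \<le> M" if "i < n" "j < n" for i j
  proof -
    have "\<bar>A $$ (i, j)\<bar> \<le> (\<Sum>j<n. \<bar>A $$ (i, j)\<bar>)" using that by (intro member_le_sum) auto
    also have "\<dots> \<le> M" unfolding M_def using that
      by (intro member_le_sum[where f = "\<lambda>i. \<Sum>j<n. \<bar>A $$ (i, j)\<bar>"]) (auto intro: sum_nonneg)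
    finally show ?thesis .
  qed
  have "\<bar>(A ^\<^sub>m k) $$ (i, j)\<bar> \<le> (n * M) ^ k" if "i < n" "j < n" for i j k
    using that
  proof (induction k arbitrary: j)
    case 0
    then show ?case using A by auto
  next
    case (Suc k)
    have "0 \<le> M" using M[OF Suc.prems] by linarith
    have "(A ^\<^sub>m Suc k) $$ (i, j) = (\<Sum>a<n. (A ^\<^sub>m k) $$ (i, a) * A $$ (a, j))"
      using Suc.prems A by (simp only: pow_mat.simps) (rule index_mult_mat_sum, auto intro: pow_carrier_mat)
    also have "\<bar>\<dots>\<bar> \<le> (\<Sum>a<n. (n * M) ^ k * M)"
      unfolding abs_mult using Suc M \<open>0 \<le> M\<close>
      by (intro order_trans[OF sum_abs] sum_mono) (auto simp: abs_mult intro!: mult_mono)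
    finally show ?case by (simp add: algebra_simps)
  qed
  then show ?thesis by blast
qed

lemma mat_exp_index:
  assumes "i < n" "j < n"
  shows "mat_exp (t \<cdot>\<^sub>m A) $$ (i, j) = (\<Sum>k. (A ^\<^sub>m k) $$ (i, j) / fact k * t ^ k)"
proof -
  have "((t \<cdot>\<^sub>m A) ^\<^sub>m k) $$ (i, j) = t ^ k * (A ^\<^sub>m k) $$ (i, j)" for k
    using assms A by (simp add: pow_mat_smult[OF A])
  then show ?thesis using assms A by (simp add: mat_exp_def mult.commute)
qed

lemma mat_exp_transpose:
  assumes "i < n" "j < n"
  shows "mat_exp (t \<cdot>\<^sub>m transpose_mat A) $$ (i, j) = mat_exp (t \<cdot>\<^sub>m A) $$ (j, i)"
proof -
  have "((t \<cdot>\<^sub>m transpose_mat A) ^\<^sub>m k) $$ (i, j) = ((t \<cdot>\<^sub>m A) ^\<^sub>m k) $$ (j, i)" for k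
  proof -
    have "t \<cdot>\<^sub>m transpose_mat A = transpose_mat (t \<cdot>\<^sub>m A)" using A by auto
    then show ?thesis using assms A pow_mat_transpose[of "t \<cdot>\<^sub>m A" n k] by simp
  qed
  then show ?thesis using assms A by (simp add: mat_exp_def)
qed

lemma mat_exp_summable:
  assumes "i < n" "j < n"
  shows "summable (\<lambda>k. (A ^\<^sub>m k) $$ (i, j) / fact k * t ^ k)"
proof -
  obtain K where K: "\<And>k. \<bar>(A ^\<^sub>m k) $$ (i, j)\<bar> \<le> K ^ k"
    using pow_mat_entry_bound assms by blast
  have "summable (\<lambda>k. inverse (fact k) * (K * \<bar>t\<bar>) ^ k)" by (rule summable_exp)
  then show ?thesis
  proof (rule summable_comparison_test'[where N = 0])
    fix k
    have "\<bar>(A ^\<^sub>m k) $$ (i, j)\<bar> * (\<bar>t\<bar> ^ k / fact k) \<le> K ^ k * (\<bar>t\<bar> ^ k / fact k)"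
      using K by (intro mult_right_mono) auto
    then show "norm ((A ^\<^sub>m k) $$ (i, j) / fact k * t ^ k) \<le> inverse (fact k) * (K * \<bar>t\<bar>) ^ k"
      by (simp add: abs_mult power_abs power_mult_distrib field_simps)
  qed
qed

lemma mat_exp_0:
  assumes "i < n" "j < n"
  shows "mat_exp (0 \<cdot>\<^sub>m A) $$ (i, j) = (if i = j then 1 else 0)"
proof -
  have "(\<lambda>k. (A ^\<^sub>m k) $$ (i, j) / fact k * 0 ^ k) sums ((A ^\<^sub>m 0) $$ (i, j) / fact 0)"
    using powser_sums_zero[of "\<lambda>k. (A ^\<^sub>m k) $$ (i, j) / fact k"] by simp
  then show ?thesis unfolding mat_exp_index[OF assms] using assms A by (simp add: sums_iff)
qed

text \<open>Termwise differentiation of a power series in \<open>t\<close>: the factor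
  \<open>k + 1\<close> cancels against the factorial, and the spare factor \<open>A\<close> splits
  off on the right.\<close>

lemma mat_exp_deriv:
  assumes i: "i < n" and j: "j < n"
  shows "((\<lambda>t. mat_exp (t \<cdot>\<^sub>m A) $$ (i, j)) has_real_derivative
    (\<Sum>a<n. mat_exp (t \<cdot>\<^sub>m A) $$ (i, a) * A $$ (a, j))) (at t)"
proof -
  let ?c = "\<lambda>i j k. (A ^\<^sub>m k) $$ (i, j) / fact k"
  have "((\<lambda>t. \<Sum>k. ?c i j k * t ^ k) has_field_derivative (\<Sum>k. diffs (?c i j) k * t ^ k)) (at t)"
    by (rule termdiffs_strong_converges_everywhere) (rule mat_exp_summable[OF i j])
  moreover have "diffs (?c i j) k * t ^ k = (\<Sum>a<n. ?c i a k * t ^ k * A $$ (a, j))" for k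
  proof -
    have "(A ^\<^sub>m Suc k) $$ (i, j) = (\<Sum>a<n. (A ^\<^sub>m k) $$ (i, a) * A $$ (a, j))"
      using i j A by (simp only: pow_mat.simps) (rule index_mult_mat_sum, auto intro: pow_carrier_mat)
    then have "(A ^\<^sub>m Suc k) $$ (i, j) / fact k * t ^ k =
        (\<Sum>a<n. (A ^\<^sub>m k) $$ (i, a) * A $$ (a, j)) / fact k * t ^ k"
      by (simp only:)
    also have "\<dots> = (\<Sum>a<n. ?c i a k * t ^ k * A $$ (a, j))"
      unfolding sum_divide_distrib sum_distrib_right by (intro sum.cong refl) simp
    finally have "(\<Sum>a<n. ?c i a k * t ^ k * A $$ (a, j)) = (A ^\<^sub>m Suc k) $$ (i, j) / fact k * t ^ k"
      by (rule sym)
    also have "\<dots> = diffs (?c i j) k * t ^ k"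
      unfolding diffs_def fact_Suc by (simp del: pow_mat.simps of_nat_Suc)
    finally show ?thesis by simp
  qed
  moreover have "(\<Sum>k. \<Sum>a<n. ?c i a k * t ^ k * A $$ (a, j)) =
    (\<Sum>a<n. (\<Sum>k. ?c i a k * t ^ k) * A $$ (a, j))"
  proof -
    have "(\<Sum>k. \<Sum>a<n. ?c i a k * t ^ k * A $$ (a, j)) =
      (\<Sum>a<n. \<Sum>k. ?c i a k * t ^ k * A $$ (a, j))"
      by (rule suminf_sum, rule summable_mult2, rule mat_exp_summable) (use i in auto)
    also have "\<dots> = (\<Sum>a<n. (\<Sum>k. ?c i a k * t ^ k) * A $$ (a, j))"
      by (rule sum.cong, rule refl, rule suminf_mult2[symmetric], rule mat_exp_summable) (use i in auto)
    finally show ?thesis .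
  qed
  ultimately show ?thesis
    using i j by (simp add: mat_exp_index)
qed

end

section \<open>Finite and infinite horizon costs\<close>

context triangular_flow
begin

abbreviation W_fun :: "(nat \<Rightarrow> real) \<Rightarrow> nat \<Rightarrow> nat \<Rightarrow> complex" where
  "W_fun p \<equiv> lyapunov_solution m J (\<lambda>i j. \<Sum>k<n. r i k * of_real (p k) * cnj (r j k))"

text \<open>Attainment in the variational formula: \<open>W u = c\<close> turns
  \<open>u^* W u\<close> into the conjugate of \<open>c^* u\<close>.\<close>

lemma W_fun_self_dual:
  assumes u: "\<And>a. a < m \<Longrightarrow> (\<Sum>b<m. W_fun p a b * u b) = r a i"
  shows "Re (\<Sum>a<m. cnj (r a i) * u a) = 2 * Re (\<Sum>a<m. cnj (r a i) * u a) - Re (sesq m (W_fun p) u u)"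
proof -
  have "sesq m (W_fun p) u u = cnj (\<Sum>a<m. cnj (r a i) * u a)"
    using sesq_apply[of m "W_fun p" u "\<lambda>a. r a i" u] u by (simp add: mult.commute)
  then show ?thesis by simp
qed

lemma dual_value_of_dual_bound:
  assumes "\<And>v. (\<Sum>i<n. 2 * Re (\<Sum>a<m. cnj (r a i) * v i a) - Re (sesq m (W_fun p) (v i) (v i))) \<le> F"
    and "\<And>i a. i < n \<Longrightarrow> a < m \<Longrightarrow> (\<Sum>b<m. W_fun p a b * u i b) = r a i"
  shows "(\<Sum>i<n. Re (\<Sum>a<m. cnj (r a i) * u i a)) \<le> F"
proof -
  have "(\<Sum>i<n. Re (\<Sum>a<m. cnj (r a i) * u i a)) =
    (\<Sum>i<n. 2 * Re (\<Sum>a<m. cnj (r a i) * u i a) - Re (sesq m (W_fun p) (u i) (u i)))"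
    using assms(2) by (intro sum.cong refl W_fun_self_dual) auto
  with assms(1)[of u] show ?thesis by simp
qed

text \<open>
  A nonzero \<open>v\<close> in the kernel of \<open>W\<close> would be detected by some column \<open>c\<close> of the upper part of
  \<open>Q\<^sup>-\<^sup>1\<close>, and then \<open>2 Re (c\<^sup>* (s v))\<close> is unbounded in the scalar \<open>s\<close>.
\<close>

lemma pos_of_dual_bound:
  assumes p: "\<And>k. k < n \<Longrightarrow> 0 \<le> p k"
    and F: "\<And>v. (\<Sum>i<n. 2 * Re (\<Sum>a<m. cnj (r a i) * v i a) - Re (sesq m (W_fun p) (v i) (v i))) \<le> F"
    and v: "j < m" "v j \<noteq> 0"
  shows "0 < Re (sesq m (W_fun p) v v)"
proof (rule ccontr)
  assume "\<not> 0 < Re (sesq m (W_fun p) v v)"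
  with lyapunov_psd[OF lyapunov_exists p] have zero: "Re (sesq m (W_fun p) v v) = 0"
    by (simp add: antisym not_less)
  have "\<exists>i<n. (\<Sum>a<m. cnj (r a i) * v a) \<noteq> 0"
  proof (rule ccontr)
    assume "\<not> ?thesis"
    then have "y (lift v) 0 j = 0"
      unfolding y_def using x_0 by (simp add: lift_def)
    then show False using v m_le_n by (simp add: y_lift)
  qed
  then obtain i where i: "i < n" "(\<Sum>a<m. cnj (r a i) * v a) \<noteq> 0" by blast
  define c where "c = (\<Sum>a<m. cnj (r a i) * v a)"
  have bound: "s * (2 * (cmod c)\<^sup>2) \<le> F" for s :: real
  proof -
    \<comment> \<open>Only slot \<open>i\<close> is used. The factor \<open>cnj c\<close> rotates
      the pairing onto the real axis, where it becomes \<open>s\<close> times the squared modulus of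
      \<open>c\<close>.\<close>
    let ?v = "\<lambda>k a. if k = i then of_real s * cnj c * v a else 0"
    have eq: "(\<Sum>a<m. cnj (r a i) * ?v i a) = of_real (s * (cmod c)\<^sup>2)"
    proof -
      have "(\<Sum>a<m. cnj (r a i) * ?v i a) = of_real s * (c * cnj c)"
        unfolding c_def sum_distrib_left sum_distrib_right by (simp add: ac_simps sum_distrib_left)
      then show ?thesis unfolding of_real_mult complex_norm_square .
    qed
    have "(\<Sum>k<n. 2 * Re (\<Sum>a<m. cnj (r a k) * ?v k a) - Re (sesq m (W_fun p) (?v k) (?v k)))
      = (\<Sum>k<n. if k = i then 2 * (s * (cmod c)\<^sup>2) else 0)"
    proof (intro sum.cong refl)
      fix k
      show "2 * Re (\<Sum>a<m. cnj (r a k) * ?v k a) - Re (sesq m (W_fun p) (?v k) (?v k)) =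
        (if k = i then 2 * (s * (cmod c)\<^sup>2) else 0)"
      proof (cases "k = i")
        case True
        have "Re (sesq m (W_fun p) (?v i) (?v i)) = 0"
          by (simp add: sesq_scale zero del: of_real_power)
        then show ?thesis using True eq by simp
      next
        case False
        then show ?thesis by (simp add: sesq_def)
      qed
    qed
    also have "\<dots> = s * (2 * (cmod c)\<^sup>2)" using i(1) by simp
    finally show ?thesis using F[of ?v] by simp
  qed
  have c: "0 < 2 * (cmod c)\<^sup>2" using i(2) by (simp add: c_def)
  obtain s where "F / (2 * (cmod c)\<^sup>2) < s" using gt_ex by blast
  then have "F < s * (2 * (cmod c)\<^sup>2)" using c by (simp add: pos_divide_less_eq)
  with bound[of s] show False by simp
qed

text \<open>By \<open>sesq_eq_total_energy\<close> the left side is affine in the weights for fixed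
  \<open>v\<close>, so coordinatewise convergence suffices.\<close>

lemma dual_bound_limit:
  assumes lim: "\<And>k. k < n \<Longrightarrow> (\<lambda>j. P j k) \<longlonglongrightarrow> p k"
    and F: "\<And>d. 0 < d \<Longrightarrow> \<forall>\<^sub>F j in sequentially.
      (\<Sum>i<n. 2 * Re (\<Sum>a<m. cnj (r a i) * v i a) - Re (sesq m (W_fun (P j)) (v i) (v i))) \<le> F + d"
  shows "(\<Sum>i<n. 2 * Re (\<Sum>a<m. cnj (r a i) * v i a) - Re (sesq m (W_fun p) (v i) (v i))) \<le> F"
proof (rule field_le_epsilon)
  fix d :: real assume d: "0 < d"
  have "(\<lambda>j. \<Sum>i<n. 2 * Re (\<Sum>a<m. cnj (r a i) * v i a) - Re (sesq m (W_fun (P j)) (v i) (v i)))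
    \<longlonglongrightarrow> (\<Sum>i<n. 2 * Re (\<Sum>a<m. cnj (r a i) * v i a) - Re (sesq m (W_fun p) (v i) (v i)))"
    unfolding sesq_eq_total_energy[OF lyapunov_exists] Re_complex_of_real
    by (intro tendsto_intros lim) auto
  then show "(\<Sum>i<n. 2 * Re (\<Sum>a<m. cnj (r a i) * v i a) - Re (sesq m (W_fun p) (v i) (v i))) \<le> F + d"
    by (rule tendsto_upperbound) (use F[OF d] in auto)
qed

text \<open>The form of \<open>p'\<close> dominates \<open>e\<close> times the form of
  \<open>p\<close>. Instead of inverting this inequality between matrices, the rescaled maximizer
  \<open>of_real e * u'\<close> belonging to \<open>p'\<close> is inserted as a test vector for
  \<open>p\<close>.\<close>

lemma dual_value_scale:
  assumes p: "\<And>k. k < n \<Longrightarrow> 0 \<le> p k" and e: "0 < e" and le: "\<And>k. k < n \<Longrightarrow> e * p k \<le> p' k"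
    and u: "\<And>a. a < m \<Longrightarrow> (\<Sum>b<m. W_fun p a b * u b) = r a i"
    and u': "\<And>a. a < m \<Longrightarrow> (\<Sum>b<m. W_fun p' a b * u' b) = r a i"
  shows "Re (\<Sum>a<m. cnj (r a i) * u' a) \<le> Re (\<Sum>a<m. cnj (r a i) * u a) / e"
proof -
  let ?c = "Re (\<Sum>a<m. cnj (r a i) * u' a)"
  have "e * Re (sesq m (W_fun p) u' u') \<le> Re (sesq m (W_fun p') u' u')"
    unfolding sesq_eq_total_energy[OF lyapunov_exists] Re_complex_of_real sum_distrib_left
    using le by (intro sum_mono) (auto simp: mult.assoc[symmetric] intro!: mult_right_mono total_energy_nonneg)
  with W_fun_self_dual[OF u'] have 1: "?c \<le> 2 * ?c - e * Re (sesq m (W_fun p) u' u')" by linarith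
  have "2 * Re (\<Sum>a<m. cnj (r a i) * (of_real e * u' a)) -
      Re (sesq m (W_fun p) (\<lambda>a. of_real e * u' a) (\<lambda>a. of_real e * u' a))
    \<le> Re (\<Sum>a<m. cnj (r a i) * u a)"
    by (rule psd_dual_bound[OF lyapunov_hermitian[OF lyapunov_exists] lyapunov_psd[OF lyapunov_exists p] u])
  moreover have "Re (\<Sum>a<m. cnj (r a i) * (of_real e * u' a)) = e * ?c"
    unfolding mult.left_commute[of _ "complex_of_real e"] sum_distrib_left[symmetric] by (simp del: Re_sum)
  moreover have "Re (sesq m (W_fun p) (\<lambda>a. of_real e * u' a) (\<lambda>a. of_real e * u' a))
      = e * (e * Re (sesq m (W_fun p) u' u'))"
    unfolding sesq_scale by (simp add: power2_eq_square)
  moreover have "e * (2 * ?c - e * Re (sesq m (W_fun p) u' u')) =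
      2 * (e * ?c) - e * (e * Re (sesq m (W_fun p) u' u'))"
    by (simp only: right_diff_distrib mult.left_commute)
  ultimately have "e * (2 * ?c - e * Re (sesq m (W_fun p) u' u')) \<le> Re (\<Sum>a<m. cnj (r a i) * u a)"
    by (simp only:)
  with mult_left_mono[OF 1, of e] e have "e * ?c \<le> Re (\<Sum>a<m. cnj (r a i) * u a)" by linarith
  then show ?thesis using e by (simp only: pos_le_divide_eq mult.commute)
qed

end

section \<open>The matrices of the problem in index form\<close>

locale jordan_setting =
  fixes n :: nat and A :: "real Matrix.mat" and Q :: "complex Matrix.mat"
    and bm bz bp :: "(nat \<times> complex) list"
  assumes A: "A \<in> carrier_mat n n"
    and decomp: "ordered_jordan_decomposition A Q bm bz bp"
begin

abbreviation "m \<equiv> blocks_size bm"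
abbreviation "JJ \<equiv> jordan_matrix (bm @ bz @ bp)"

lemma jordan_decomposition:
  "JJ \<in> carrier_mat n n" "Q \<in> carrier_mat n n" "mat_inv Q \<in> carrier_mat n n"
  "Q * mat_inv Q = 1\<^sub>m n" "mat_inv Q * Q = 1\<^sub>m n"
  "map_mat complex_of_real A = Q * JJ * mat_inv Q"
proof -
  have "n = dim_row (map_mat complex_of_real A)"
    "similar_mat_wit (map_mat complex_of_real A) JJ Q (mat_inv Q)"
    using decomp A by (simp_all add: ordered_jordan_decomposition_def)
  from similar_mat_witD[OF this]
  show "JJ \<in> carrier_mat n n" "Q \<in> carrier_mat n n" "mat_inv Q \<in> carrier_mat n n"
    "Q * mat_inv Q = 1\<^sub>m n" "mat_inv Q * Q = 1\<^sub>m n"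
    "map_mat complex_of_real A = Q * JJ * mat_inv Q"
    by blast+
qed

lemma size_sum: "n = m + blocks_size bz + blocks_size bp"
  using jordan_decomposition(1) by (auto simp: blocks_size_def)

lemma JJ_diag_rest:
  assumes "m \<le> i" "i < n"
  shows "0 \<le> Re (JJ $$ (i, i))"
proof -
  have 1: "i < blocks_size (bm @ bz @ bp)" "i - m < blocks_size (bz @ bp)"
    using assms size_sum by (auto simp: blocks_size_def)
  have "JJ $$ (i, i) = jordan_matrix (bz @ bp) $$ (i - m, i - m)"
    using jordan_matrix_append_index[OF 1(1) 1(1)] assms(1) by simp
  with jordan_matrix_diag[OF 1(2)] obtain k l where "(k, l) \<in> set (bz @ bp)" "JJ $$ (i, i) = l"
    by auto
  then show ?thesis
    using decomp by (fastforce simp: ordered_jordan_decomposition_def)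
qed

lemma JJ_minus:
  assumes "i < m" "j < n"
  shows "JJ $$ (i, j) = (if j < m then jordan_matrix bm $$ (i, j) else 0)"
  using assms size_sum by (subst jordan_matrix_append_index) (auto simp: blocks_size_def)

lemma JJ_diag_minus:
  assumes "i < m"
  shows "Re (JJ $$ (i, i)) < 0"
proof -
  have "JJ $$ (i, i) = jordan_matrix bm $$ (i, i)"
    using assms size_sum by (simp add: JJ_minus)
  with jordan_matrix_diag[OF assms] obtain k l where "(k, l) \<in> set bm" "JJ $$ (i, i) = l"
    by auto
  then show ?thesis
    using decomp by (fastforce simp: ordered_jordan_decomposition_def)
qed

sublocale triangular_flow n m "\<lambda>i j. A $$ (i, j)" "\<lambda>i j. Q $$ (i, j)" "\<lambda>i j. mat_inv Q $$ (i, j)"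
  "\<lambda>i j. JJ $$ (i, j)" "\<lambda>t i j. mat_exp (t \<cdot>\<^sub>m A) $$ (i, j)"
proof
  show "m \<le> n" using size_sum by simp
  show "(\<Sum>a<n. complex_of_real (A $$ (k, a)) * Q $$ (a, j)) = (\<Sum>a<n. Q $$ (k, a) * JJ $$ (a, j))"
    if "k < n" "j < n" for k j
  proof -
    have "map_mat complex_of_real A * Q = Q * JJ * (mat_inv Q * Q)"
      unfolding jordan_decomposition(6) by (rule assoc_mult_mat[of _ n n _ n _ n]) (use jordan_decomposition in auto)
    then have "map_mat complex_of_real A * Q = Q * JJ" unfolding jordan_decomposition(5) using jordan_decomposition by auto
    then have "(map_mat complex_of_real A * Q) $$ (k, j) = (Q * JJ) $$ (k, j)" by simp
    moreover have "(map_mat complex_of_real A * Q) $$ (k, j) = (\<Sum>a<n. map_mat complex_of_real A $$ (k, a) * Q $$ (a, j))"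
      by (rule index_mult_mat_sum) (use A jordan_decomposition that in auto)
    moreover have "(Q * JJ) $$ (k, j) = (\<Sum>a<n. Q $$ (k, a) * JJ $$ (a, j))"
      by (rule index_mult_mat_sum) (use A jordan_decomposition that in auto)
    ultimately show ?thesis using A that by simp
  qed
  show "(\<Sum>k<n. Q $$ (i, k) * mat_inv Q $$ (k, j)) = (if i = j then 1 else 0)"
    if "i < n" "j < n" for i j
    using index_mult_mat_sum[OF jordan_decomposition(2,3) that] that unfolding jordan_decomposition(4) by simp
  show "(\<Sum>k<n. mat_inv Q $$ (i, k) * Q $$ (k, j)) = (if i = j then 1 else 0)"
    if "i < n" "j < n" for i j
    using index_mult_mat_sum[OF jordan_decomposition(3,2) that] that unfolding jordan_decomposition(5) by simp
  show "JJ $$ (i, j) = 0" if "j < i" "i < n" for i j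
    by (rule jordan_matrix_upper_triangular) (use that jordan_decomposition(1) in auto)
  show "JJ $$ (i, j) = 0" if "i < m" "m \<le> j" "j < n" for i j
    using that by (simp add: JJ_minus)
  show "mat_exp (0 \<cdot>\<^sub>m A) $$ (i, j) = (if i = j then 1 else 0)" if "i < n" "j < n" for i j
    using A that by (rule mat_exp_0)
  show "((\<lambda>t. mat_exp (t \<cdot>\<^sub>m A) $$ (i, j)) has_real_derivative
      (\<Sum>a<n. mat_exp (t \<cdot>\<^sub>m A) $$ (i, a) * A $$ (a, j))) (at t)" if "i < n" "j < n" for i j t
    using A that by (rule mat_exp_deriv)
qed (rule JJ_diag_minus JJ_diag_rest; assumption)+

lemma gramian_carrier: "gramian A p T \<in> carrier_mat n n"
  using A by (simp add: gramian_def)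

lemma gramian_index:
  assumes p: "p \<in> carrier_vec n" and ij: "i < n" "j < n"
  shows "gramian A p T $$ (i, j) = gram (vec_index p) T i j"
proof -
  let ?E = "\<lambda>t i j. mat_exp (t \<cdot>\<^sub>m A) $$ (i, j)"
  have E: "mat_exp (t \<cdot>\<^sub>m A) \<in> carrier_mat n n" "mat_exp (t \<cdot>\<^sub>m transpose_mat A) \<in> carrier_mat n n" for t
    using A by (auto simp: mat_exp_def)
  have "(mat_exp (t \<cdot>\<^sub>m A) * diag_of_vec p * mat_exp (t \<cdot>\<^sub>m transpose_mat A)) $$ (i, j)
    = (\<Sum>k<n. p $ k * (?E t i k * ?E t j k))" for t
  proof -
    have "mat_exp (t \<cdot>\<^sub>m A) * diag_of_vec p = Matrix.mat n n (\<lambda>(i, j). ?E t i j * p $ j)"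
      unfolding diag_of_vec_def carrier_vecD[OF p] by (rule mat_diag_mult_right[OF E(1)])
    then show ?thesis
      using ij A by (subst index_mult_mat_sum[OF _ E(2)]) (auto simp: mat_exp_transpose[OF A] ac_simps)
  qed
  then have "gramian A p T $$ (i, j) = integral {0..T} (\<lambda>t. \<Sum>k<n. p $ k * (?E t i k * ?E t j k))"
    using A ij by (simp add: gramian_def)
  also have "\<dots> = gram (vec_index p) T i j"
    unfolding gram_def using ij
    by (subst integral_sum) (auto intro!: integrable_on_mult_right integrable_EE)
  finally show ?thesis .
qed

lemma std_simplexD:
  assumes "p \<in> std_simplex n"
  shows "p \<in> carrier_vec n" "k < n \<Longrightarrow> 0 \<le> p $ k" "k < n \<Longrightarrow> p $ k \<le> 1" "(\<Sum>k<n. p $ k) = 1"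
proof -
  show "p \<in> carrier_vec n" "(\<Sum>k<n. p $ k) = 1" and nn: "k < n \<Longrightarrow> 0 \<le> p $ k" for k
    using assms by (auto simp: std_simplex_def)
  then show "p $ k \<le> 1" if "k < n"
    using member_le_sum[of k "{..<n}" "\<lambda>k. p $ k"] that by auto
qed

lemma aecs_feasible_inverse:
  assumes f: "aecs_feasible A T p" and i: "i < n" and j: "j < n"
  shows "(\<Sum>k<n. gram (vec_index p) T j k * mat_inv (gramian A p T) $$ (k, i)) = (if j = i then 1 else 0)"
proof -
  have p: "p \<in> carrier_vec n" and pd: "pos_def (gramian A p T)"
    using f A std_simplexD(1) by (auto simp: aecs_feasible_def)
  note inv = mat_inv_pos_def[OF gramian_carrier pd]
  have "(gramian A p T * mat_inv (gramian A p T)) $$ (j, i) =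
    (\<Sum>k<n. gramian A p T $$ (j, k) * mat_inv (gramian A p T) $$ (k, i))"
    by (rule index_mult_mat_sum[OF gramian_carrier inv(1) j i])
  then show ?thesis unfolding inv(2) using i j by (simp add: gramian_index[OF p j])
qed

lemma aecs_cost_eq:
  assumes f: "aecs_feasible A T p"
  shows "aecs_cost A T p = (\<Sum>i<n. mat_inv (gramian A p T) $$ (i, i))"
proof -
  have "pos_def (gramian A p T)" using f by (auto simp: aecs_feasible_def)
  from mat_inv_pos_def[OF gramian_carrier this] show ?thesis
    by (auto simp: aecs_cost_def mat_trace_def)
qed

text \<open>Real vectors are embedded into the complex ones, where the quadratic form of the Gramian
  is a weighted energy and \<open>energy_pos\<close> applies.\<close>

lemma aecs_feasible_pos:
  assumes p: "p \<in> std_simplex n" and pos: "\<And>k. k < n \<Longrightarrow> 0 < p $ k" and T: "0 < T"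
  shows "aecs_feasible A T p"
proof -
  note pc = std_simplexD(1)[OF p]
  let ?G = "gramian A p T"
  have G: "dim_row ?G = n" "dim_col ?G = n" using gramian_carrier[of p T] by auto
  have adj: "mat_adjoint ?G = ?G"
    using G by (intro eq_matI) (auto simp: conjugate_real_def gramian_index[OF pc] gram_sym)
  have "0 < (?G *\<^sub>v v) \<bullet>c v" if v: "v \<in> carrier_vec n" "v \<noteq> 0\<^sub>v n" for v
  proof -
    obtain i where i: "i < n" "v $ i \<noteq> 0" using v by (auto simp: vec_eq_iff)
    let ?z = "\<lambda>i. complex_of_real (v $ i)"
    have "complex_of_real ((?G *\<^sub>v v) \<bullet>c v) = sesq n (\<lambda>i j. of_real (gram (vec_index p) T i j)) ?z ?z"
      using v G unfolding sesq_def
      by (simp add: scalar_prod_def lessThan_atLeast0[symmetric] conjugate_real_def sum_distrib_left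
          sum_distrib_right gramian_index[OF pc] ac_simps)
    then have "(?G *\<^sub>v v) \<bullet>c v = (\<Sum>k<n. p $ k * energy ?z T k)"
      unfolding sesq_gram of_real_eq_iff .
    then show ?thesis using energy_pos[OF pos T i(1), where z = ?z] i(2) by simp
  qed
  then show ?thesis using p A adj G by (simp add: aecs_feasible_def pos_def_def)
qed

lemma B_minus_index:
  assumes p: "p \<in> carrier_vec n" and ij: "i < m" "j < m"
  shows "B_minus Q bm p $$ (i, j) =
    (\<Sum>k<n. mat_inv Q $$ (i, k) * of_real (p $ k) * cnj (mat_inv Q $$ (j, k)))"
proof -
  note Qi = jordan_decomposition(3)
  have ij': "i < n" "j < n" using ij m_le_n by auto
  have D: "map_mat complex_of_real (diag_of_vec p) = mat_diag n (\<lambda>k. of_real (p $ k))"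
    using p by (intro eq_matI) (auto simp: diag_of_vec_def mat_diag_def)
  have "B_minus Q bm p $$ (i, j) =
      (mat_inv Q * mat_diag n (\<lambda>k. of_real (p $ k)) * mat_adjoint (mat_inv Q)) $$ (i, j)"
    unfolding B_minus_def D split_block_def Let_def using ij by simp
  also have "\<dots> = (\<Sum>k<n. (mat_inv Q * mat_diag n (\<lambda>k. of_real (p $ k))) $$ (i, k) * mat_adjoint (mat_inv Q) $$ (k, j))"
    by (rule index_mult_mat_sum[OF _ mat_adjoint_carrier[OF Qi] ij']) (use Qi in auto)
  also have "\<dots> = (\<Sum>k<n. mat_inv Q $$ (i, k) * of_real (p $ k) * cnj (mat_inv Q $$ (j, k)))"
    unfolding mat_diag_mult_right[OF Qi] using Qi ij' by (auto simp: conjugate_complex_def)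
  finally show ?thesis .
qed

lemma B_minus_carrier: "B_minus Q bm p \<in> carrier_mat m m"
  unfolding B_minus_def split_block_def Let_def by simp

lemma lyapunov_mat_iff:
  assumes p: "p \<in> carrier_vec n" and X: "X \<in> carrier_mat m m"
  shows "jordan_matrix bm * X + X * mat_adjoint (jordan_matrix bm) + B_minus Q bm p = 0\<^sub>m m m
    \<longleftrightarrow> lyapunov (vec_index p) (\<lambda>i j. X $$ (i, j))"
proof -
  have J: "jordan_matrix bm \<in> carrier_mat m m" unfolding blocks_size_def by simp
  note J' = mat_adjoint_carrier[OF J]
  have adj: "mat_adjoint (jordan_matrix bm) $$ (i, j) = cnj (jordan_matrix bm $$ (j, i))"
    if "i < m" "j < m" for i j
    using that by (simp add: blocks_size_def conjugate_complex_def)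
  have JJ: "JJ $$ (i, j) = jordan_matrix bm $$ (i, j)" if "i < m" "j < m" for i j
    using that m_le_n by (simp add: JJ_minus)
  have idx: "(jordan_matrix bm * X + X * mat_adjoint (jordan_matrix bm) + B_minus Q bm p) $$ (i, j)
    = (\<Sum>a<m. JJ $$ (i, a) * X $$ (a, j)) + (\<Sum>a<m. X $$ (i, a) * cnj (JJ $$ (j, a))) +
      (\<Sum>k<n. mat_inv Q $$ (i, k) * of_real (p $ k) * cnj (mat_inv Q $$ (j, k)))"
    if ij: "i < m" "j < m" for i j
  proof -
    have "(jordan_matrix bm * X) $$ (i, j) = (\<Sum>a<m. JJ $$ (i, a) * X $$ (a, j))"
      unfolding index_mult_mat_sum[OF J X ij] using ij by (simp add: JJ)
    moreover have "(X * mat_adjoint (jordan_matrix bm)) $$ (i, j) = (\<Sum>a<m. X $$ (i, a) * cnj (JJ $$ (j, a)))"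
      unfolding index_mult_mat_sum[OF X J' ij] using ij by (simp add: JJ adj)
    ultimately show ?thesis
      using ij carrier_matD[OF mult_carrier_mat[OF J X]] carrier_matD[OF mult_carrier_mat[OF X J']]
        carrier_matD[OF B_minus_carrier[of p]]
      by (simp add: B_minus_index[OF p] del: index_mult_mat)
  qed
  have dim: "jordan_matrix bm * X + X * mat_adjoint (jordan_matrix bm) + B_minus Q bm p \<in> carrier_mat m m"
    using J X B_minus_carrier[of p] by auto
  show ?thesis
    unfolding lyapunov_def mat_eq_iff using dim idx by auto
qed

lemma W_minus_eq:
  assumes p: "p \<in> carrier_vec n"
  shows "W_minus Q bm p = Matrix.mat m m (\<lambda>(i, j). W_fun (vec_index p) i j)"
  unfolding W_minus_def
proof (rule the_equality)
  let ?X = "Matrix.mat m m (\<lambda>(i, j). W_fun (vec_index p) i j)"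
  have X: "?X \<in> carrier_mat m m" by simp
  have ex: "lyapunov (vec_index p) (W_fun (vec_index p))" by (rule lyapunov_exists)
  then have "lyapunov (vec_index p) (\<lambda>i j. ?X $$ (i, j))"
    by (simp add: lyapunov_def)
  then show "?X \<in> carrier_mat m m \<and>
      jordan_matrix bm * ?X + ?X * mat_adjoint (jordan_matrix bm) + B_minus Q bm p = 0\<^sub>m m m"
    using X lyapunov_mat_iff[OF p X] by blast
  fix Y
  assume "Y \<in> carrier_mat m m \<and>
      jordan_matrix bm * Y + Y * mat_adjoint (jordan_matrix bm) + B_minus Q bm p = 0\<^sub>m m m"
  then have Y: "Y \<in> carrier_mat m m" and "lyapunov (vec_index p) (\<lambda>i j. Y $$ (i, j))"
    using lyapunov_mat_iff[OF p] by blast+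
  from lyapunov_unique[OF this(2) ex] Y show "Y = ?X" by (intro eq_matI) auto
qed

lemma aecs_feasible_inf_iff:
  "aecs_feasible_inf Q bm p \<longleftrightarrow> p \<in> std_simplex n \<and>
    (\<forall>v. (\<exists>a<m. v a \<noteq> 0) \<longrightarrow> 0 < Re (sesq m (W_fun (vec_index p)) v v))"
proof -
  have "pos_def (W_minus Q bm p) \<longleftrightarrow>
    (\<forall>v. (\<exists>a<m. v a \<noteq> 0) \<longrightarrow> 0 < Re (sesq m (W_fun (vec_index p)) v v))"
    if "p \<in> std_simplex n"
    unfolding W_minus_eq[OF std_simplexD(1)[OF that]]
    by (rule pos_def_complex_iff) (rule lyapunov_hermitian[OF lyapunov_exists])
  then show ?thesis using jordan_decomposition(2) by (auto simp: aecs_feasible_inf_def)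
qed

text \<open>Splits the trace into \<open>n\<close> dual values, one for each column of
  \<open>Q^-1\<close> cut off after \<open>m\<close> entries; the maximizers are
  \<open>u i = W_-(p)^-1 c\<close> for these truncated columns \<open>c\<close>.\<close>

lemma aecs_cost_inf_eq:
  assumes f: "aecs_feasible_inf Q bm p"
  obtains u where "\<And>i a. i < n \<Longrightarrow> a < m \<Longrightarrow> (\<Sum>b<m. W_fun (vec_index p) a b * u i b) = mat_inv Q $$ (a, i)"
    and "aecs_cost_inf Q bm bz bp p = (\<Sum>i<n. Re (\<Sum>a<m. cnj (mat_inv Q $$ (a, i)) * u i a))"
proof
  note Qi = jordan_decomposition(3)
  have p: "p \<in> carrier_vec n" using f std_simplexD(1) by (simp add: aecs_feasible_inf_iff)
  have W: "W_minus Q bm p \<in> carrier_mat m m" by (simp add: W_minus_eq[OF p])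
  have pd: "pos_def (W_minus Q bm p)" using f by (simp add: aecs_feasible_inf_def)
  note inv = mat_inv_pos_def[OF W pd]
  let ?V = "mat_inv (W_minus Q bm p)"
  define u where "u i b = (\<Sum>c<m. ?V $$ (b, c) * mat_inv Q $$ (c, i))" for i b
  show "(\<Sum>b<m. W_fun (vec_index p) a b * u i b) = mat_inv Q $$ (a, i)" if "i < n" "a < m" for i a
  proof -
    have "(\<Sum>b<m. W_fun (vec_index p) a b * u i b) =
      (\<Sum>c<m. (\<Sum>b<m. W_fun (vec_index p) a b * ?V $$ (b, c)) * mat_inv Q $$ (c, i))"
      unfolding u_def sum_distrib_left sum_distrib_right by (subst sum.swap) (simp add: ac_simps)
    also have "\<dots> = (\<Sum>c<m. (W_minus Q bm p * ?V) $$ (a, c) * mat_inv Q $$ (c, i))"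
      using that by (intro sum.cong refl, subst index_mult_mat_sum[OF W inv(1)]) (auto simp: W_minus_eq[OF p])
    also have "\<dots> = (\<Sum>c<m. if c = a then mat_inv Q $$ (c, i) else 0)"
      unfolding inv(2) using that by (intro sum.cong refl) auto
    finally show ?thesis using that by simp
  qed
  let ?D = "diag_block_mat [?V, 0\<^sub>m (blocks_size bz) (blocks_size bz), 0\<^sub>m (blocks_size bp) (blocks_size bp)]"
  have D: "?D \<in> carrier_mat n n" using inv(1) size_sum by (auto simp: Let_def)
  have D_idx: "?D $$ (a, b) = (if a < m \<and> b < m then ?V $$ (a, b) else 0)" if "a < n" "b < n" for a b
    using that inv(1) size_sum by (auto simp: Let_def)
  let ?M = "mat_adjoint (mat_inv Q) * ?D * mat_inv Q"
  have MD: "mat_adjoint (mat_inv Q) * ?D \<in> carrier_mat n n"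
    using mat_adjoint_carrier[OF Qi] D by (rule mult_carrier_mat)
  have "?M $$ (i, i) = (\<Sum>a<m. cnj (mat_inv Q $$ (a, i)) * u i a)" if i: "i < n" for i
  proof -
    have "?M $$ (i, i) = (\<Sum>b<n. (\<Sum>a<n. mat_adjoint (mat_inv Q) $$ (i, a) * ?D $$ (a, b)) * mat_inv Q $$ (b, i))"
      unfolding index_mult_mat_sum[OF MD Qi i i] using i
      by (intro sum.cong refl, subst index_mult_mat_sum[OF mat_adjoint_carrier[OF Qi] D]) auto
    also have "\<dots> = (\<Sum>b<n. (\<Sum>a<n. cnj (mat_inv Q $$ (a, i)) * (if a < m \<and> b < m then ?V $$ (a, b) else 0)) * mat_inv Q $$ (b, i))"
      using i Qi by (intro sum.cong refl arg_cong2[where f = "(*)"])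
        (auto simp: D_idx conjugate_complex_def simp del: diag_block_mat.simps)
    also have "\<dots> = (\<Sum>b<m. (\<Sum>a<n. cnj (mat_inv Q $$ (a, i)) * (if a < m \<and> b < m then ?V $$ (a, b) else 0)) * mat_inv Q $$ (b, i))"
      using m_le_n by (intro sum.mono_neutral_right) auto
    also have "\<dots> = (\<Sum>b<m. (\<Sum>a<m. cnj (mat_inv Q $$ (a, i)) * ?V $$ (a, b)) * mat_inv Q $$ (b, i))"
      using m_le_n by (intro sum.cong refl arg_cong2[where f = "(*)"] sum.mono_neutral_cong_right) auto
    also have "\<dots> = (\<Sum>a<m. cnj (mat_inv Q $$ (a, i)) * u i a)"
      unfolding u_def sum_distrib_left sum_distrib_right by (subst sum.swap) (simp add: ac_simps)
    finally show ?thesis .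
  qed
  moreover have "dim_row ?M = n" using Qi by simp
  ultimately show "aecs_cost_inf Q bm bz bp p = (\<Sum>i<n. Re (\<Sum>a<m. cnj (mat_inv Q $$ (a, i)) * u i a))"
    unfolding aecs_cost_inf_def mat_trace_def by (simp only: Re_sum) simp
qed

end

section \<open>Limits of finite-horizon optima\<close>

context jordan_setting
begin

text \<open>
  The minimizer of the infinite-horizon problem need not be feasible for a finite horizon, so it is
  compared through its mixture with the uniform distribution.
\<close>

lemma mixture_feasible_inf:
  assumes p: "aecs_feasible_inf Q bm p" and e: "0 < e" "e < 1"
  defines "p' \<equiv> Matrix.vec n (\<lambda>k. e * p $ k + (1 - e) / real n)"
  assumes n: "0 < n"
  shows "aecs_feasible_inf Q bm p'" "k < n \<Longrightarrow> 0 < p' $ k"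
    "aecs_cost_inf Q bm bz bp p' \<le> aecs_cost_inf Q bm bz bp p / e"
proof -
  have ps: "p \<in> std_simplex n" using p by (simp add: aecs_feasible_inf_iff)
  note pD = std_simplexD[OF ps]
  \<comment> \<open>This single strict inequality yields both the positivity of \<open>p'\<close>
    and the domination that \<open>dual_value_scale\<close> uses.\<close>
  have gt: "e * p $ k < p' $ k" if "k < n" for k
    using that e n by (simp add: p'_def)
  show pos: "0 < p' $ k" if "k < n" for k
    using gt[OF that] pD(2)[OF that] e(1) by (meson le_less_trans mult_nonneg_nonneg less_imp_le)
  have "(\<Sum>k<n. p' $ k) = e * (\<Sum>k<n. p $ k) + (1 - e)"
    using n by (simp add: p'_def sum.distrib sum_distrib_left)
  then have p's: "p' \<in> std_simplex n"
    using pos pD(4) by (auto simp: std_simplex_def less_imp_le p'_def)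
  show feas: "aecs_feasible_inf Q bm p'"
    unfolding aecs_feasible_inf_iff
  proof (intro conjI p's allI impI)
    fix v :: "nat \<Rightarrow> complex"
    assume "\<exists>a<m. v a \<noteq> 0"
    then have "0 < Re (sesq m (W_fun (vec_index p)) v v)"
      using p by (auto simp: aecs_feasible_inf_iff)
    then have "0 < e * Re (sesq m (W_fun (vec_index p)) v v)" using e by simp
    also have "\<dots> \<le> Re (sesq m (W_fun (vec_index p')) v v)"
      unfolding sesq_eq_total_energy[OF lyapunov_exists] Re_complex_of_real sum_distrib_left mult.assoc[symmetric]
      using gt by (intro sum_mono mult_right_mono total_energy_nonneg) (auto intro: less_imp_le)
    finally show "0 < Re (sesq m (W_fun (vec_index p')) v v)" .
  qed
  obtain u where u: "\<And>i a. i < n \<Longrightarrow> a < m \<Longrightarrow> (\<Sum>b<m. W_fun (vec_index p) a b * u i b) = mat_inv Q $$ (a, i)"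
    and cu: "aecs_cost_inf Q bm bz bp p = (\<Sum>i<n. Re (\<Sum>a<m. cnj (mat_inv Q $$ (a, i)) * u i a))"
    using aecs_cost_inf_eq[OF p] by blast
  obtain u' where u': "\<And>i a. i < n \<Longrightarrow> a < m \<Longrightarrow> (\<Sum>b<m. W_fun (vec_index p') a b * u' i b) = mat_inv Q $$ (a, i)"
    and cu': "aecs_cost_inf Q bm bz bp p' = (\<Sum>i<n. Re (\<Sum>a<m. cnj (mat_inv Q $$ (a, i)) * u' i a))"
    using aecs_cost_inf_eq[OF feas] by blast
  have "Re (\<Sum>a<m. cnj (mat_inv Q $$ (a, i)) * u' i a) \<le> Re (\<Sum>a<m. cnj (mat_inv Q $$ (a, i)) * u i a) / e"
    if "i < n" for i
    by (rule dual_value_scale[OF pD(2) e(1) less_imp_le[OF gt] u[OF that] u'[OF that]])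
  then show "aecs_cost_inf Q bm bz bp p' \<le> aecs_cost_inf Q bm bz bp p / e"
    unfolding cu cu' sum_divide_distrib by (intro sum_mono) auto
qed

lemma eventually_aecs_cost_le:
  assumes p: "aecs_feasible_inf Q bm p" and pos: "\<And>k. k < n \<Longrightarrow> 0 < p $ k"
    and d: "0 < d"
  shows "\<forall>\<^sub>F T in at_top. aecs_cost A T p \<le> aecs_cost_inf Q bm bz bp p + d"
proof -
  have ps: "p \<in> std_simplex n" using p by (simp add: aecs_feasible_inf_iff)
  note feas = aecs_feasible_pos[OF ps pos]
  obtain u where u: "\<And>i a. i < n \<Longrightarrow> a < m \<Longrightarrow> (\<Sum>b<m. W_fun (vec_index p) a b * u i b) = mat_inv Q $$ (a, i)"
    and cu: "aecs_cost_inf Q bm bz bp p = (\<Sum>i<n. Re (\<Sum>a<m. cnj (mat_inv Q $$ (a, i)) * u i a))"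
    using aecs_cost_inf_eq[OF p] by blast
  let ?V = "\<lambda>T i j. mat_inv (gramian A p T) $$ (i, j)"
  \<comment> \<open>The slack is shared among \<open>n\<close> diagonal entries; the denominator
    \<open>n + 1\<close> is positive also for \<open>n = 0\<close>.\<close>
  have "\<forall>\<^sub>F T in at_top. \<forall>i\<in>{..<n}. ?V T i i \<le> Re (\<Sum>a<m. cnj (mat_inv Q $$ (a, i)) * u i a) + d / real (n + 1)"
  proof (rule eventually_ball_finite, simp, intro ballI)
    fix i assume "i \<in> {..<n}"
    then have i: "i < n" by simp
    show "\<forall>\<^sub>F T in at_top. ?V T i i \<le> Re (\<Sum>a<m. cnj (mat_inv Q $$ (a, i)) * u i a) + d / real (n + 1)"
      by (rule gram_inverse_upper_bound[OF pos lyapunov_exists u[OF i] aecs_feasible_inverse[OF feas] i])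
        (use d in auto)
  qed
  with eventually_gt_at_top[of 0] show ?thesis
  proof eventually_elim
    case (elim T)
    have "aecs_cost A T p = (\<Sum>i<n. ?V T i i)"
      using elim(1) by (intro aecs_cost_eq feas) auto
    also have "\<dots> \<le> (\<Sum>i<n. Re (\<Sum>a<m. cnj (mat_inv Q $$ (a, i)) * u i a) + d / real (n + 1))"
      using elim(2) by (intro sum_mono) auto
    also have "\<dots> = aecs_cost_inf Q bm bz bp p + real n * (d / real (n + 1))"
      by (simp add: cu sum.distrib)
    also have "real n * (d / real (n + 1)) \<le> d"
      using d by (simp add: field_simps)
    finally show ?case by simp
  qed
qed

text \<open>Half of \<open>d\<close> pays for replacing \<open>p\<close> by its mixture, with
  \<open>e\<close> close enough to 1, and half for the finite horizon at that fixed mixture, which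
  is an admissible competitor of \<open>P T\<close>.\<close>

lemma eventually_optimal_cost_le:
  assumes p: "aecs_feasible_inf Q bm p" and n: "0 < n" and d: "0 < d"
    and P: "\<And>T. T > 0 \<Longrightarrow> is_arg_min (aecs_cost A T) (aecs_feasible A T) (P T)"
  shows "\<forall>\<^sub>F T in at_top. aecs_cost A T (P T) \<le> aecs_cost_inf Q bm bz bp p + d"
proof -
  let ?F = "aecs_cost_inf Q bm bz bp p"
  have "((\<lambda>e. ?F / e) \<longlongrightarrow> ?F / 1) (at_left 1)"
    by (intro tendsto_intros) auto
  then have "\<forall>\<^sub>F e in at_left 1. ?F / e < ?F + d / 2"
    using d by (intro order_tendstoD(2)) auto
  moreover have "\<forall>\<^sub>F e in at_left (1 :: real). e \<in> {0<..<1}"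
    by (rule eventually_at_left_real) simp
  ultimately have "\<forall>\<^sub>F e in at_left 1. ?F / e < ?F + d / 2 \<and> e \<in> {0<..<1}"
    by (rule eventually_conj)
  then obtain e where e: "0 < e" "e < 1" "?F / e < ?F + d / 2"
    using eventually_happens'[OF trivial_limit_at_left_real] by force
  let ?p = "Matrix.vec n (\<lambda>k. e * p $ k + (1 - e) / real n)"
  note mix = mixture_feasible_inf[OF p e(1,2) n]
  have ps: "?p \<in> std_simplex n" using mix(1) by (simp add: aecs_feasible_inf_iff)
  have "\<forall>\<^sub>F T in at_top. aecs_cost A T ?p \<le> aecs_cost_inf Q bm bz bp ?p + d / 2"
    using d by (intro eventually_aecs_cost_le mix) auto
  with eventually_gt_at_top[of 0] show ?thesis
  proof eventually_elim
    case (elim T)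
    have "aecs_feasible A T ?p" by (rule aecs_feasible_pos[OF ps mix(2) elim(1)])
    then have "aecs_cost A T (P T) \<le> aecs_cost A T ?p"
      using P[OF elim(1)] by (auto simp: is_arg_min_def not_less)
    with elim(2) mix(3) e(3) show ?case by linarith
  qed
qed

lemma optimal_limit_is_arg_min:
  assumes p_inf: "is_arg_min (aecs_cost_inf Q bm bz bp) (aecs_feasible_inf Q bm) p_inf"
    and n: "0 < n"
    and P: "\<And>T. T > 0 \<Longrightarrow> is_arg_min (aecs_cost A T) (aecs_feasible A T) (P T)"
    and T: "filterlim T at_top sequentially" "\<And>j. 0 < T j"
    and lim: "\<And>k. k < n \<Longrightarrow> (\<lambda>j. P (T j) $ k) \<longlonglongrightarrow> l k"
  shows "is_arg_min (aecs_cost_inf Q bm bz bp) (aecs_feasible_inf Q bm) (Matrix.vec n l)"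
proof -
  let ?q = "Matrix.vec n l" and ?F = "aecs_cost_inf Q bm bz bp p_inf"
  have feas: "aecs_feasible A (T j) (P (T j))" for j
    using P[OF T(2)] by (simp add: is_arg_min_def)
  then have simplex: "P (T j) \<in> std_simplex n" for j
    using A by (auto simp: aecs_feasible_def)
  have inf: "aecs_feasible_inf Q bm p_inf" using p_inf by (simp add: is_arg_min_def)
  have l_nonneg: "0 \<le> l k" if "k < n" for k
    by (rule LIMSEQ_le_const[OF lim[OF that]]) (use std_simplexD(2)[OF simplex that] in blast)
  have "(\<lambda>j. \<Sum>k<n. P (T j) $ k) \<longlonglongrightarrow> (\<Sum>k<n. l k)"
    by (intro tendsto_sum lim) auto
  then have "(\<Sum>k<n. l k) = 1"
    unfolding std_simplexD(4)[OF simplex] by (simp add: LIMSEQ_const_iff)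
  then have q: "?q \<in> std_simplex n"
    using l_nonneg by (auto simp: std_simplex_def)
  \<comment> \<open>The dual expression lies below the cost at horizon \<open>T j\<close>, which
    eventually lies below \<open>?F + d\<close>. The resulting bound at the limit gives both
    feasibility of \<open>?q\<close> and an infinite-horizon cost of at most
    \<open>?F\<close>.\<close>
  have dual: "(\<Sum>i<n. 2 * Re (\<Sum>a<m. cnj (mat_inv Q $$ (a, i)) * v i a)
      - Re (sesq m (W_fun (vec_index ?q)) (v i) (v i))) \<le> ?F" for v
  proof (rule dual_bound_limit[where P = "\<lambda>j. vec_index (P (T j))"])
    show "(\<lambda>j. P (T j) $ k) \<longlonglongrightarrow> ?q $ k" if "k < n" for k
      using lim[OF that] that by simp
    fix d :: real assume d: "0 < d"
    have "\<forall>\<^sub>F j in sequentially. aecs_cost A (T j) (P (T j)) \<le> ?F + d"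
      by (rule eventually_compose_filterlim[OF eventually_optimal_cost_le[OF inf n d P] T(1)])
    then show "\<forall>\<^sub>F j in sequentially. (\<Sum>i<n. 2 * Re (\<Sum>a<m. cnj (mat_inv Q $$ (a, i)) * v i a)
      - Re (sesq m (W_fun (vec_index (P (T j)))) (v i) (v i))) \<le> ?F + d"
    proof eventually_elim
      case (elim j)
      have "(\<Sum>i<n. 2 * Re (\<Sum>a<m. cnj (mat_inv Q $$ (a, i)) * v i a)
          - Re (sesq m (W_fun (vec_index (P (T j)))) (v i) (v i)))
        \<le> (\<Sum>i<n. mat_inv (gramian A (P (T j)) (T j)) $$ (i, i))"
      proof (rule sum_mono)
        fix i assume "i \<in> {..<n}"
        then have i: "i < n" by simp
        show "2 * Re (\<Sum>a<m. cnj (mat_inv Q $$ (a, i)) * v i a)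
          - Re (sesq m (W_fun (vec_index (P (T j)))) (v i) (v i))
          \<le> mat_inv (gramian A (P (T j)) (T j)) $$ (i, i)"
          by (rule gram_inverse_lower_bound[OF std_simplexD(2)[OF simplex] lyapunov_exists
                aecs_feasible_inverse[OF feas i] i])
      qed
      also have "\<dots> = aecs_cost A (T j) (P (T j))" by (rule aecs_cost_eq[OF feas, symmetric])
      finally show ?case using elim by simp
    qed
  qed
  have q_nonneg: "0 \<le> ?q $ k" if "k < n" for k using l_nonneg that by simp
  have q_inf: "aecs_feasible_inf Q bm ?q"
    unfolding aecs_feasible_inf_iff using q pos_of_dual_bound[OF q_nonneg dual] by blast
  obtain u where u: "\<And>i a. i < n \<Longrightarrow> a < m \<Longrightarrow> (\<Sum>b<m. W_fun (vec_index ?q) a b * u i b) = mat_inv Q $$ (a, i)"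
    and cu: "aecs_cost_inf Q bm bz bp ?q = (\<Sum>i<n. Re (\<Sum>a<m. cnj (mat_inv Q $$ (a, i)) * u i a))"
    using aecs_cost_inf_eq[OF q_inf] by blast
  have "aecs_cost_inf Q bm bz bp ?q \<le> ?F"
    unfolding cu by (rule dual_value_of_dual_bound[OF dual u])
  with p_inf q_inf show ?thesis
    unfolding is_arg_min_def by (meson less_le_trans)
qed

end

text \<open>Subsequence argument: if convergence failed in some coordinate, boundedness of the
  simplex would give a limit point that differs from \<open>p_inf\<close>, yet every limit point is
  an infinite-horizon minimizer.\<close>

theorem theorem3:
  fixes n :: nat
    and A :: "real Matrix.mat"
    and Q :: "complex Matrix.mat"
    and bm bz bp :: "(nat \<times> complex) list"
    and p_inf :: "real Matrix.vec"
    and p :: "real \<Rightarrow> real Matrix.vec"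
  assumes "A \<in> carrier_mat n n"
    and "ordered_jordan_decomposition A Q bm bz bp"
    and "\<exists>l. eigenvalue (map_mat complex_of_real A) l \<and> Re l < 0"
    and "is_arg_min (aecs_cost_inf Q bm bz bp) (aecs_feasible_inf Q bm) p_inf"
    and "\<And>q. is_arg_min (aecs_cost_inf Q bm bz bp) (aecs_feasible_inf Q bm) q \<Longrightarrow> q = p_inf"
    and "\<And>T. T > 0 \<Longrightarrow> is_arg_min (aecs_cost A T) (aecs_feasible A T) (p T)"
  shows "\<forall>i<n. ((\<lambda>T. vec_index (p T) i) \<longlongrightarrow> vec_index p_inf i) at_top"
proof (intro allI impI, rule ccontr)
  interpret jordan_setting n A Q bm bz bp
    using assms(1,2) by unfold_locales
  fix i assume i: "i < n" and not_lim: "\<not> ((\<lambda>T. p T $ i) \<longlongrightarrow> p_inf $ i) at_top"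
  from not_lim obtain e where e: "0 < e" "\<not> (\<forall>\<^sub>F T in at_top. dist (p T $ i) (p_inf $ i) < e)"
    by (auto simp: tendsto_iff)
  \<comment> \<open>\<open>Suc k\<close> instead of \<open>k\<close> keeps every chosen horizon
    positive, so that the optimality assumption applies to it.\<close>
  have "\<exists>T. real (Suc k) \<le> T \<and> e \<le> dist (p T $ i) (p_inf $ i)" for k
    using e(2) unfolding eventually_at_top_linorder by (meson not_less)
  then obtain T where T: "\<And>k. real (Suc k) \<le> T k" "\<And>k. e \<le> dist (p (T k) $ i) (p_inf $ i)"
    by metis
  have T_pos: "0 < T k" for k using T(1)[of k] by simp
  have "\<exists>C. \<forall>k. \<bar>p (T k) $ j\<bar> \<le> C" if "j < n" for j
  proof -
    have "p (T k) \<in> std_simplex n" for k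
      using assms(6)[OF T_pos] assms(1) by (auto simp: is_arg_min_def aecs_feasible_def)
    from std_simplexD(2,3)[OF this that] show ?thesis
      by (intro exI[of _ 1]) auto
  qed
  then obtain s l where s: "strict_mono s" and l: "\<And>j. j < n \<Longrightarrow> (\<lambda>k. p (T (s k)) $ j) \<longlonglongrightarrow> l j"
    using bounded_seq_subseq_convergent[of n "\<lambda>k j. p (T k) $ j"] by blast
  have "filterlim (\<lambda>k. T (s k)) at_top sequentially"
  proof (rule filterlim_at_top_mono[OF filterlim_real_sequentially], rule always_eventually, rule allI)
    fix k show "real k \<le> T (s k)" using T(1)[of "s k"] seq_suble[OF s, of k] by linarith
  qed
  \<comment> \<open>The index \<open>i < n\<close> supplies the remaining premise
    \<open>0 < n\<close>.\<close>
  from optimal_limit_is_arg_min[OF assms(4) _ assms(6) this T_pos l] i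
  have "Matrix.vec n l = p_inf" by (intro assms(5)) auto
  then have l_eq: "l i = p_inf $ i" using i by auto
  have "(\<lambda>k. dist (p (T (s k)) $ i) (p_inf $ i)) \<longlonglongrightarrow> 0"
    using l[OF i] unfolding l_eq by (rule tendsto_dist_iff[THEN iffD1])
  then have "e \<le> 0" by (rule LIMSEQ_le_const) (use T(2) in blast)
  with e(1) show False by simp
qed

end
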